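(* Let $\mathcal L$ be an alphabet all of whose letters are negative, let $k$ be a field, and let $D$ be a row-convex shape. Then the elements $[T]$, $T$ running over the straight tableaux of shape $D$ on $\mathcal L$, form a SAGBI basis of the $k$-algebra $R^D$ with respect to any diagonal term order.
   Context: $\mathcal L$ is a totally ordered set, all of whose elements are called negative letters. A shape is a finite set of cells $(i,j)$ (row $i$ counted from top, column $j$ counted from left). A tableau $T$ of shape $D$ on $\mathcal L$ assigns a letter $T_{i,j}\in\mathcal L$ to each cell. $D$ is row-convex if $(r,i),(r,k)\in D$ and $i<j<k$ imply $(r,j)\in D$; rows are assumed sorted so that higher rows end at least as far to the right as lower rows. A tableau of row-convex shape (with negative letters) is straight if (1) entries strictly increase from left to right in each row, and (2) for cells $(i,k),(j,k)\in D$ with $i<j$ and $T_{i,k}>T_{j,k}$, the cell $(i,k-1)$ exists in $D$ and $T_{i,k-1}\ge T_{j,k}$. Let $\mathcal P$ be a finite set of column indices containing the columns of $D$ and let $k[(a|p)]_{a\in\mathcal L,\,p\in\mathcal P}$ be the commutative polynomial ring in variables $(a|p)$. For a row with entries $w_1,\dots,w_n$ in columns $p_1<\dots<p_n$, let $(w_1,\dots,w_n|p_1,\dots,p_n)=(-1)^{\binom n2}\det\big((w_r|p_s)\big)_{r,s}$; $[T]$ is the product of these polynomials over the rows of $T$. $R^D$ is the $k$-subalgebra generated by all $[T]$, $T$ a tableau of shape $D$ on $\mathcal L$. A diagonal term order is a total order $\prec$ on monomials such that $m\prec m'$ and $n\prec n'$ imply $mn\prec m'n'$, and such that the smallest monomial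 of $(i_1,\dots,i_n|j_1,\dots,j_n)$ with $i_1<\dots<i_n$, $j_1<\dots<j_n$ is $\prod_l(i_l|j_l)$. Convention: the initial monomial of a nonzero polynomial is its smallest monomial with respect to $\prec$. A SAGBI basis of a subalgebra $R$ is a generating set $G$ of $R$ such that the initial monomial of every nonzero element of $R$ lies in the algebra generated by the initial monomials of the elements of $G$. *)

theory Defs
  imports "Jordan_Normal_Form.Determinant" "HOL-Library.Poly_Mapping"
begin

section \<open>Row-convex shapes and straight tableaux\<close>

text \<open>Cells are pairs (row, column); rows are counted from the top, columns from the left.\<close>

type_synonym shape = "(nat \<times> nat) set"

definition row_columns :: "shape \<Rightarrow> nat \<Rightarrow> nat set" where
  "row_columns D i = {j. (i, j) \<in> D}"

definition row_convex :: "shape \<Rightarrow> bool" where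
  "row_convex D \<longleftrightarrow> (\<forall>r i j k. (r, i) \<in> D \<and> (r, k) \<in> D \<and> i < j \<and> j < k \<longrightarrow> (r, j) \<in> D)"

text \<open>Higher rows end at least as far to the right as lower rows. A row without cells has no
  end and is not constrained.\<close>

definition rows_sorted :: "shape \<Rightarrow> bool" where
  "rows_sorted D \<longleftrightarrow> (\<forall>i i'. i < i' \<and> row_columns D i \<noteq> {} \<and> row_columns D i' \<noteq> {} \<longrightarrow>
     Max (row_columns D i') \<le> Max (row_columns D i))"

definition row_convex_shape :: "shape \<Rightarrow> bool" where
  "row_convex_shape D \<longleftrightarrow> finite D \<and> row_convex D \<and> rows_sorted D"

text \<open>A tableau of shape \<open>D\<close> is represented by a total function; its values outside \<open>D\<close> are
  irrelevant to every notion below. All letters are negative.\<close>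

type_synonym 'a tableau = "nat \<Rightarrow> nat \<Rightarrow> 'a"

text \<open>The guard \<open>0 < k\<close> is needed because \<open>k - 1 = k\<close> for \<open>k = 0\<close>: there is no column to the
  left of column 0.\<close>

definition straight :: "shape \<Rightarrow> 'a::linorder tableau \<Rightarrow> bool" where
  "straight D T \<longleftrightarrow>
     (\<forall>i j k. (i, j) \<in> D \<and> (i, k) \<in> D \<and> j < k \<longrightarrow> T i j < T i k) \<and>
     (\<forall>i j k. (i, k) \<in> D \<and> (j, k) \<in> D \<and> i < j \<and> T i k > T j k \<longrightarrow>
        0 < k \<and> (i, k - 1) \<in> D \<and> T i (k - 1) \<ge> T j k)"


section \<open>The polynomial ring and the polynomials $[T]$\<close>

text \<open>Monomials in the letterplace variables $(a|p)$ are exponent functions of finite support,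
  written additively; polynomials are finitely supported functions from monomials to \<open>'k\<close>,
  multiplied by convolution.\<close>

type_synonym 'a lmonom = "('a \<times> nat) \<Rightarrow>\<^sub>0 nat"
type_synonym ('a, 'k) lpoly = "'a lmonom \<Rightarrow>\<^sub>0 'k"

definition monom_var :: "'a \<Rightarrow> nat \<Rightarrow> 'a lmonom" where
  "monom_var a p = Poly_Mapping.single (a, p) 1"

definition poly_of_monom :: "'a lmonom \<Rightarrow> ('a, 'k::comm_ring_1) lpoly" where
  "poly_of_monom m = Poly_Mapping.single m 1"

definition biproduct :: "'a list \<Rightarrow> nat list \<Rightarrow> ('a, 'k::comm_ring_1) lpoly" where
  "biproduct ws ps = (let n = length ws in
     (- 1) ^ (n choose 2) *
       det (mat n n (\<lambda>(r, s). poly_of_monom (monom_var (ws ! r) (ps ! s)))))"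

definition row_biproduct :: "shape \<Rightarrow> 'a tableau \<Rightarrow> nat \<Rightarrow> ('a, 'k::comm_ring_1) lpoly" where
  "row_biproduct D T i = (let ps = sorted_list_of_set (row_columns D i) in biproduct (map (T i) ps) ps)"

definition bracket :: "shape \<Rightarrow> 'a tableau \<Rightarrow> ('a, 'k::comm_ring_1) lpoly" where
  "bracket D T = (\<Prod>i \<in> fst ` D. row_biproduct D T i)"

definition subalgebra :: "('a, 'k::comm_ring_1) lpoly set \<Rightarrow> bool" where
  "subalgebra A \<longleftrightarrow> (\<forall>c. Poly_Mapping.single 0 c \<in> A) \<and>
     (\<forall>f\<in>A. \<forall>g\<in>A. f + g \<in> A \<and> f * g \<in> A)"

definition shape_algebra :: "shape \<Rightarrow> ('a, 'k::comm_ring_1) lpoly set" where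
  "shape_algebra D = subalgebra hull (range (bracket D))"


section \<open>Diagonal term orders and SAGBI bases\<close>

definition monoms_over :: "nat set \<Rightarrow> 'a lmonom set" where
  "monoms_over P = {m. Poly_Mapping.keys m \<subseteq> UNIV \<times> P}"

text \<open>Convention: the initial monomial is the smallest one. It is only meaningful for a nonzero
  polynomial.\<close>

definition initial_monom ::
  "('a lmonom \<Rightarrow> 'a lmonom \<Rightarrow> bool) \<Rightarrow> ('a, 'k::comm_ring_1) lpoly \<Rightarrow> 'a lmonom" where
  "initial_monom prec f =
     (THE m. m \<in> Poly_Mapping.keys f \<and> (\<forall>m' \<in> Poly_Mapping.keys f. m' \<noteq> m \<longrightarrow> prec m m'))"

text \<open>The relation \<open>prec\<close> is the strict part of the order, and only its restriction to the
  monomials in the variables $(a|p)$ with \<open>p \<in> P\<close> matters. The first argument fixes the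
  coefficient field over which initial monomials are taken.\<close>

definition diagonal_term_order ::
  "'k::comm_ring_1 itself \<Rightarrow> nat set \<Rightarrow> ('a::linorder lmonom \<Rightarrow> 'a lmonom \<Rightarrow> bool) \<Rightarrow> bool" where
  "diagonal_term_order _ P prec \<longleftrightarrow>
     irreflp_on (monoms_over P) prec \<and>
     transp_on (monoms_over P) prec \<and>
     totalp_on (monoms_over P) prec \<and>
     (\<forall>m \<in> monoms_over P. \<forall>m' \<in> monoms_over P. \<forall>n \<in> monoms_over P. \<forall>n' \<in> monoms_over P.
        prec m m' \<and> prec n n' \<longrightarrow> prec (m + n) (m' + n')) \<and>
     (\<forall>is js. length is = length js \<and> sorted_wrt (<) is \<and> sorted_wrt (<) js \<and> set js \<subseteq> P \<longrightarrow>
        initial_monom prec (biproduct is js :: ('a, 'k) lpoly) =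
          (\<Sum>l < length is. monom_var (is ! l) (js ! l)))"

text \<open>Initial monomials are taken of the nonzero elements of \<open>G\<close> only.\<close>

definition sagbi_basis ::
  "('a lmonom \<Rightarrow> 'a lmonom \<Rightarrow> bool) \<Rightarrow> ('a, 'k::comm_ring_1) lpoly set \<Rightarrow>
     ('a, 'k) lpoly set \<Rightarrow> bool" where
  "sagbi_basis prec R G \<longleftrightarrow>
     subalgebra hull G = R \<and>
     (\<forall>f \<in> R. f \<noteq> 0 \<longrightarrow>
        (poly_of_monom (initial_monom prec f) :: ('a, 'k) lpoly) \<in>
          subalgebra hull ((\<lambda>g. poly_of_monom (initial_monom prec g)) ` (G - {0})))"

end

theory Submission
  imports Defs "HOL-Library.Product_Lexorder"
begin

text \<open>
  The initial monomial of \<open>[T]\<close>, for \<open>T\<close> with increasing rows, is its diagonal monomial, which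
  records the content of each column, and a straight tableau is determined by its column contents.
  So the straight tableaux have pairwise distinct initial monomials, and everything reduces to
  showing that they span.

  For two rows, a determinantal exchange identity rewrites a non-straight product of minors in terms
  of pairs that are smaller for a suitable order. Comparing initial monomials, a non-straight pair
  inside a larger tableau is replaced by pairs whose diagonal monomial is larger, or is the same but
  with a smaller entry in the first cell, column by column, that changes; this terminates, so straight tableaux span for every row-convex
  shape.

  Products of \<open>n\<close> generators are the \<open>[T]\<close> of the shape in which each row is repeated \<open>n\<close> times,
  which is again row-convex. Hence the initial monomial of an element of the algebra is the diagonal
  monomial of a straight tableau of such a multiple shape, i.e. a product of diagonal monomials of
  tableaux of the original shape.
\<close>

section \<open>Determinants with two blocks of columns\<close>

text \<open>The two-row step rests on one determinant. Its columns are those of the upper row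
  followed by those of the lower row, its rows are the letters of both, and weights \<open>0\<close>
  and \<open>1\<close> bar some letters from one of the blocks. Where a column index occurs in both
  blocks, subtracting one copy from the other changes the weights on the second block. If the upper
  row starts strictly to the right of the lower one, too few columns remain and the determinant
  vanishes: a relation of Garnir type. Otherwise it need not vanish but has a second expansion. In
  the first family of terms the largest letter to change rows goes up, in the second it goes down.
  The obstacle is a measure that falls for both, and \<open>exchange_key\<close> is built for this.

  Neither the term order nor the alphabet is assumed well-founded, so termination for larger
  tableaux is measured inside the finite set of diagonal monomials on the letters of the given
  tableau. Finally, an element of the algebra may mix products of different lengths; the degree in a
  single column tells these apart.\<close>

abbreviation lpvar :: "'a \<Rightarrow> nat \<Rightarrow> ('a, 'k::comm_ring_1) lpoly" where
  "lpvar a p \<equiv> poly_of_monom (monom_var a p)"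

definition minor :: "nat \<Rightarrow> 'a::linorder set \<Rightarrow> ('a, 'k::comm_ring_1) lpoly" where
  "minor p X = biproduct (sorted_list_of_set X) [p..<p + card X]"

text \<open>A Laplace term for the columns cut into the first \<open>m\<close> and the last
  \<open>n\<close>: up to sign, a product of two complementary minors. As a sum over permutations it
  carries its sign without a formula for it.\<close>

definition split_det ::
  "nat \<Rightarrow> nat \<Rightarrow> (nat \<Rightarrow> nat \<Rightarrow> 'r) \<Rightarrow> (nat \<Rightarrow> nat \<Rightarrow> 'r) \<Rightarrow> nat set \<Rightarrow> 'r::comm_ring_1" where
  "split_det m n f g S =
     (\<Sum>\<pi> | \<pi> permutes {0..<m + n} \<and> {r \<in> {0..<m + n}. \<pi> r < m} = S.
        signof \<pi> * (\<Prod>r = 0..<m + n. if \<pi> r < m then f r (\<pi> r) else g r (\<pi> r - m)))"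

text \<open>Laplace expansion along the first \<open>m\<close> columns. The row weights act on the
  two blocks separately and factor out of each term, so weights \<open>0\<close> and
  \<open>1\<close> select the row sets \<open>S\<close> that survive.\<close>

lemma det_two_blocks:
  fixes f g :: "nat \<Rightarrow> nat \<Rightarrow> 'r::comm_ring_1"
  shows "det (mat (m + n) (m + n) (\<lambda>(r, c). if c < m then \<alpha> r * f r c else \<beta> r * g r (c - m))) =
    (\<Sum>S\<in>Pow {0..<m + n}. (\<Prod>r\<in>S. \<alpha> r) * (\<Prod>r\<in>{0..<m + n} - S. \<beta> r) * split_det m n f g S)"
    (is "det ?M = _")
proof -
  let ?U = "{0..<m + n}"
  let ?PU = "{\<pi>. \<pi> permutes ?U}"
  let ?S = "\<lambda>\<pi>. {r \<in> ?U. \<pi> r < m}"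
  let ?h = "\<lambda>\<pi>. signof \<pi> * (\<Prod>r\<in>?U. ?M $$ (r, \<pi> r))"
  have "det ?M = sum ?h ?PU"
    by (rule det_def') simp
  also have "\<dots> = (\<Sum>S\<in>Pow ?U. sum ?h {\<pi> \<in> ?PU. ?S \<pi> = S})"
    by (rule sum.group[symmetric]) (auto simp: finite_permutations)
  also have "\<dots> = (\<Sum>S\<in>Pow ?U. (\<Prod>r\<in>S. \<alpha> r) * (\<Prod>r\<in>?U - S. \<beta> r) * split_det m n f g S)"
  proof (rule sum.cong[OF refl])
    fix S assume "S \<in> Pow ?U"
    then have S: "S \<subseteq> ?U" by simp
    have "?h \<pi> = (\<Prod>r\<in>S. \<alpha> r) * (\<Prod>r\<in>?U - S. \<beta> r) *
        (signof \<pi> * (\<Prod>r = 0..<m + n. if \<pi> r < m then f r (\<pi> r) else g r (\<pi> r - m)))"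
      if "\<pi> permutes ?U" "?S \<pi> = S" for \<pi>
    proof -
      have lt: "\<pi> r < m + n" if "r < m + n" for r
        using \<open>\<pi> permutes ?U\<close> that by (metis atLeastLessThan_iff permutes_in_image zero_le)
      have "(\<Prod>r\<in>?U. ?M $$ (r, \<pi> r)) =
          (\<Prod>r\<in>?U. (if r \<in> S then \<alpha> r else \<beta> r) *
             (if \<pi> r < m then f r (\<pi> r) else g r (\<pi> r - m)))"
        using lt \<open>?S \<pi> = S\<close>[symmetric] by (intro prod.cong) auto
      also have "\<dots> = (\<Prod>r\<in>?U. if r \<in> S then \<alpha> r else \<beta> r) *
          (\<Prod>r = 0..<m + n. if \<pi> r < m then f r (\<pi> r) else g r (\<pi> r - m))"
        by (simp add: prod.distrib)
      also have "(\<Prod>r\<in>?U. if r \<in> S then \<alpha> r else \<beta> r) = (\<Prod>r\<in>S. \<alpha> r) * (\<Prod>r\<in>?U - S. \<beta> r)"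
        using S by (simp add: prod.If_cases Int_absorb1 Diff_eq)
      finally show ?thesis by (simp add: mult_ac)
    qed
    then show "sum ?h {\<pi> \<in> ?PU. ?S \<pi> = S} =
        (\<Prod>r\<in>S. \<alpha> r) * (\<Prod>r\<in>?U - S. \<beta> r) * split_det m n f g S"
      unfolding split_det_def sum_distrib_left by (intro sum.cong) auto
  qed
  finally show ?thesis .
qed

text \<open>The indicators of \<open>S\<close> and of its complement, taken as weights, kill all
  other Laplace terms: a set \<open>R\<close> different from \<open>S\<close> contains a row outside
  \<open>S\<close> or misses a row of \<open>S\<close>.\<close>

lemma split_det_eq_det:
  fixes f g :: "nat \<Rightarrow> nat \<Rightarrow> 'r::comm_ring_1"
  assumes "S \<subseteq> {0..<m + n}"
  shows "split_det m n f g S =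
    det (mat (m + n) (m + n)
      (\<lambda>(r, c). if c < m then (if r \<in> S then f r c else 0) else (if r \<in> S then 0 else g r (c - m))))"
    (is "_ = det ?M")
proof -
  let ?U = "{0..<m + n}"
  let ?\<alpha> = "\<lambda>r. of_bool (r \<in> S) :: 'r" and ?\<beta> = "\<lambda>r. of_bool (r \<notin> S) :: 'r"
  let ?t = "\<lambda>R. (\<Prod>r\<in>R. ?\<alpha> r) * (\<Prod>r\<in>?U - R. ?\<beta> r) * split_det m n f g R"
  have "?M = mat (m + n) (m + n) (\<lambda>(r, c). if c < m then ?\<alpha> r * f r c else ?\<beta> r * g r (c - m))"
    by (intro eq_matI) auto
  then have "det ?M = (\<Sum>R\<in>Pow ?U. ?t R)"
    by (simp only: det_two_blocks[of m n ?\<alpha> f ?\<beta> g])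
  also have "\<dots> = ?t S + (\<Sum>R\<in>Pow ?U - {S}. ?t R)"
    using assms by (intro sum.remove) auto
  also have "(\<Sum>R\<in>Pow ?U - {S}. ?t R) = 0"
  proof (rule sum.neutral, rule ballI)
    fix R assume R: "R \<in> Pow ?U - {S}"
    then have fin: "finite R" by (auto intro: finite_subset)
    from R assms consider r where "r \<in> R" "r \<notin> S" | r where "r \<in> ?U - R" "r \<in> S" by blast
    then show "?t R = 0"
    proof cases
      case 1
      then have "(\<Prod>r\<in>R. ?\<alpha> r) = 0" using fin by (intro prod_zero) auto
      then show ?thesis by (simp only: mult_zero_left)
    next
      case 2
      then have "(\<Prod>r\<in>?U - R. ?\<beta> r) = 0" by (intro prod_zero) auto
      then show ?thesis by (simp only: mult_zero_left mult_zero_right)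
    qed
  qed
  also have "?t S = split_det m n f g S"
    using assms by (simp add: prod.neutral)
  finally show ?thesis by (simp only: add_0_right)
qed

text \<open>A contributing permutation maps \<open>S\<close> bijectively onto the first
  \<open>m\<close> columns.\<close>

lemma split_det_wrong_card:
  assumes "card S \<noteq> m"
  shows "split_det m n f g S = 0"
proof -
  have "False" if "\<pi> permutes {0..<m + n}" "{r \<in> {0..<m + n}. \<pi> r < m} = S" for \<pi>
  proof -
    have "bij_betw \<pi> S {0..<m}"
      unfolding bij_betw_def
    proof
      show "inj_on \<pi> S" using that(1) by (meson inj_on_subset permutes_inj subset_UNIV)
      show "\<pi> ` S = {0..<m}"
      proof
        show "\<pi> ` S \<subseteq> {0..<m}" using that(2) by auto
        show "{0..<m} \<subseteq> \<pi> ` S"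
        proof
          fix c assume c: "c \<in> {0..<m}"
          then have "c \<in> \<pi> ` {0..<m + n}" using permutes_image[OF that(1)] by auto
          then show "c \<in> \<pi> ` S" using c that(2)[symmetric] by auto
        qed
      qed
    qed
    then show False using assms by (simp add: bij_betw_same_card)
  qed
  then have "{\<pi>. \<pi> permutes {0..<m + n} \<and> {r \<in> {0..<m + n}. \<pi> r < m} = S} = {}" by blast
  then show ?thesis unfolding split_det_def by (simp only: sum.empty)
qed

section \<open>Reordering the letters of a minor\<close>

lemma det_mset_rows:
  fixes h :: "'b \<Rightarrow> nat \<Rightarrow> 'r::comm_ring_1"
  assumes "mset xs = mset ys"
  shows "\<exists>e\<in>{1, -1}. det (mat (length xs) (length xs) (\<lambda>(r, c). h (xs ! r) c)) =
    e * det (mat (length ys) (length ys) (\<lambda>(r, c). h (ys ! r) c))"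
proof -
  obtain f where f: "f permutes {..<length ys}" "permute_list f ys = xs"
    using mset_eq_permutation[OF assms] by metis
  have len: "length xs = length ys" using assms by (rule mset_eq_length)
  let ?n = "length ys"
  have f': "f permutes {0..<?n}" using f(1) by (simp add: atLeast0LessThan)
  let ?A = "mat ?n ?n (\<lambda>(r, c). h (ys ! r) c)"
  have "mat (length xs) (length xs) (\<lambda>(r, c). h (xs ! r) c) = mat ?n ?n (\<lambda>(i, j). ?A $$ (f i, j))"
  proof (rule eq_matI)
    fix i j assume ij: "i < dim_row (mat ?n ?n (\<lambda>(i, j). ?A $$ (f i, j)))"
      "j < dim_col (mat ?n ?n (\<lambda>(i, j). ?A $$ (f i, j)))"
    then have "f i < ?n" using f' by (metis atLeastLessThan_iff dim_row_mat(1) permutes_in_image zero_le)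
    moreover have "xs ! i = ys ! f i"
      using ij f by (metis dim_row_mat(1) permute_list_nth)
    ultimately show "mat (length xs) (length xs) (\<lambda>(r, c). h (xs ! r) c) $$ (i, j) =
        mat ?n ?n (\<lambda>(i, j). ?A $$ (f i, j)) $$ (i, j)"
      using ij len by simp
  qed (simp_all add: len)
  then have "det (mat (length xs) (length xs) (\<lambda>(r, c). h (xs ! r) c)) = signof f * det ?A"
    using det_permute_rows[OF _ f', of ?A] by simp
  moreover have "(signof f :: 'r) \<in> {1, -1}" by (rule signof_pm_one)
  ultimately show ?thesis by (rule bexI)
qed

lemma biproduct_not_distinct:
  assumes "\<not> distinct ws"
  shows "biproduct ws ps = (0 :: ('a, 'k::comm_ring_1) lpoly)"
proof -
  let ?n = "length ws"
  let ?A = "mat ?n ?n (\<lambda>(r, s). lpvar (ws ! r) (ps ! s)) :: ('a, 'k) lpoly mat"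
  obtain i j where ij: "i < ?n" "j < ?n" "i \<noteq> j" "ws ! i = ws ! j"
    using assms by (auto simp: distinct_conv_nth)
  have "det ?A = 0"
    by (rule det_identical_rows[of _ ?n i j]) (use ij in \<open>auto intro!: eq_vecI\<close>)
  then show ?thesis by (simp add: biproduct_def Let_def)
qed

lemma minus_one_power_cases: "(- 1 :: 'r::ring_1) ^ n \<in> {1, -1}"
  by (cases "even n") auto

lemma biproduct_distinct:
  assumes "distinct ws"
  shows "\<exists>e\<in>{1, -1}. biproduct ws [p..<p + length ws] = e * (minor p (set ws) :: ('a::linorder, 'k::comm_ring_1) lpoly)"
proof -
  let ?n = "length ws"
  let ?h = "\<lambda>a s. lpvar a ([p..<p + ?n] ! s) :: ('a, 'k) lpoly"
  have ms: "mset ws = mset (sorted_list_of_set (set ws))"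
    using assms by (simp add: set_eq_iff_mset_eq_distinct[symmetric])
  from det_mset_rows[OF this, of ?h] show ?thesis
    using mset_eq_length[OF ms, symmetric] assms
    by (auto simp: biproduct_def minor_def Let_def distinct_card)
qed

text \<open>Spans are taken over the coefficients, which act through constant polynomials; this
  keeps linear combinations and products inside one type.\<close>

interpretation lpm: Modules.module "\<lambda>c (f :: ('a, 'k::comm_ring_1) lpoly). Poly_Mapping.single 0 c * f"
  by unfold_locales (simp_all add: algebra_simps single_add mult_single)

lemma prod_in_units_or_zero:
  fixes h :: "'b \<Rightarrow> 'r::comm_ring_1"
  assumes "\<And>r. r \<in> A \<Longrightarrow> h r \<in> {0, 1, -1}"
  shows "prod h A \<in> {0, 1, -1}"
  using assms
proof (induction A rule: infinite_finite_induct)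
  case (insert x A)
  then have "h x \<in> {0, 1, -1}" "prod h A \<in> {0, 1, -1}" by auto
  then have "h x * prod h A \<in> {0, 1, -1}" by (elim insertE) simp_all
  then show ?case using insert by simp
qed auto

text \<open>In the exchange identities the coefficients are products of weights computed as
  polynomials. Since they are \<open>0\<close>, \<open>1\<close> or \<open>-1\<close>, they act as
  scalars, and membership has to be shown only for terms whose coefficient does not vanish.\<close>

lemma span_scale_unit_or_zero:
  assumes "e \<in> {0, 1, -1}" "e \<noteq> 0 \<Longrightarrow> f \<in> lpm.span T"
  shows "e * f \<in> lpm.span T"
  using assms lpm.span_zero lpm.span_neg[of f T] by auto

section \<open>Exchange identities for two blocks of columns\<close>

lemma det_zero_pigeonhole:
  fixes A :: "'r::comm_ring_1 mat"
  assumes A: "A \<in> carrier_mat N N" and R: "R \<subseteq> {0..<N}" and C: "finite C" "card C < card R"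
    and z: "\<And>r c. r \<in> R \<Longrightarrow> c < N \<Longrightarrow> c \<notin> C \<Longrightarrow> A $$ (r, c) = 0"
  shows "det A = 0"
  unfolding det_def'[OF A]
proof (rule sum.neutral, rule ballI)
  fix \<pi> assume "\<pi> \<in> {\<pi>. \<pi> permutes {0..<N}}"
  then have \<pi>: "\<pi> permutes {0..<N}" by simp
  \<comment> \<open>A permutation cannot squeeze the rows \<open>R\<close> into the smaller set
    \<open>C\<close>, so each product in the Leibniz formula meets a zero entry.\<close>
  have "\<not> \<pi> ` R \<subseteq> C"
  proof
    assume "\<pi> ` R \<subseteq> C"
    then have "card R \<le> card C"
      using C(1) by (metis card_image card_mono inj_on_subset permutes_inj[OF \<pi>] subset_UNIV)
    then show False using C(2) by simp
  qed
  then obtain r where r: "r \<in> R" "\<pi> r \<notin> C" by auto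
  then have "\<pi> r < N" using R permutes_in_image[OF \<pi>, of r] by auto
  then have "A $$ (r, \<pi> r) = 0" using z r by blast
  moreover have "r \<in> {0..<N}" using r R by blast
  ultimately have "(\<Prod>i = 0..<N. A $$ (i, \<pi> i)) = 0" by (intro prod_zero) auto
  then show "signof \<pi> * (\<Prod>i = 0..<N. A $$ (i, \<pi> i)) = 0" by simp
qed

text \<open>A column index that belongs to both blocks allows a column operation: its first copy is
  subtracted from its second. The weight there becomes \<beta> - \<alpha>, which vanishes on every
  row where the two weights agree.\<close>

lemma det_subtract_columns:
  fixes x :: "nat \<Rightarrow> nat \<Rightarrow> 'r::comm_ring_1"
  shows "det (mat (m + n) (m + n) (\<lambda>(r, c). if c < m then \<alpha> r * x r (p + c) else \<beta> r * x r (p' + (c - m)))) =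
    det (mat (m + n) (m + n) (\<lambda>(r, c). if c < m then \<alpha> r * x r (p + c)
      else (\<beta> r - \<alpha> r * of_bool (p \<le> p' + (c - m) \<and> p' + (c - m) < p + m)) * x r (p' + (c - m))))"
    (is "det ?M = det ?M'")
proof -
  let ?N = "m + n"
  let ?g = "\<lambda>c d. c < m \<and> m \<le> d \<and> p + c = p' + (d - m)"
  \<comment> \<open>Encodes all the subtractions at once. Since columns of the first block are
    subtracted from columns of the second, the matrix is unitriangular and the determinant is
    unchanged.\<close>
  let ?E = "mat ?N ?N (\<lambda>(c, d). of_bool (c = d) - of_bool (?g c d)) :: 'r mat"
  have "?M' = ?M * ?E"
  proof (rule eq_matI)
    fix r d assume "r < dim_row (?M * ?E)" "d < dim_col (?M * ?E)"
    then have r: "r < ?N" and d: "d < ?N" by auto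
    have "(?M * ?E) $$ (r, d) = (\<Sum>c = 0..<?N. ?M $$ (r, c) * ?E $$ (c, d))"
      using r d by (simp add: scalar_prod_def)
    also have "\<dots> = (\<Sum>c = 0..<?N. if c = d then ?M $$ (r, c) else 0) -
        (\<Sum>c = 0..<?N. if ?g c d then ?M $$ (r, c) else 0)"
      unfolding sum_subtractf[symmetric] using d by (intro sum.cong) auto
    also have "(\<Sum>c = 0..<?N. if c = d then ?M $$ (r, c) else 0) = ?M $$ (r, d)"
      using d by simp
    also have "(\<Sum>c = 0..<?N. if ?g c d then ?M $$ (r, c) else 0) =
        (if m \<le> d \<and> p \<le> p' + (d - m) \<and> p' + (d - m) < p + m
         then \<alpha> r * x r (p' + (d - m)) else 0)" (is "?s = ?t")
    proof (cases "m \<le> d \<and> p \<le> p' + (d - m) \<and> p' + (d - m) < p + m")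
      case True
      define c0 where "c0 = p' + (d - m) - p"
      have c0: "c0 < m" "p + c0 = p' + (d - m)" using True unfolding c0_def by auto
      have "?s = (\<Sum>c = 0..<?N. if c = c0 then ?M $$ (r, c) else 0)"
        using True c0 by (intro sum.cong) auto
      also have "\<dots> = ?t" using True c0 r by simp
      finally show ?thesis .
    next
      case False
      then have "\<not> ?g c d" for c by linarith
      then show ?thesis using False by (simp only: if_False sum.neutral_const)
    qed
    also have "?M $$ (r, d) - ?t = ?M' $$ (r, d)"
      using r d by (auto simp: algebra_simps)
    finally show "?M' $$ (r, d) = (?M * ?E) $$ (r, d)" by (rule sym)
  qed simp_all
  moreover have "det ?E = 1"
  proof -
    have "det ?E = prod_list (diag_mat ?E)"
      by (rule det_upper_triangular[where n = ?N]) (auto simp: upper_triangular_def)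
    also have "\<dots> = 1" by (auto simp: prod_list_diag_prod intro!: prod.neutral)
    finally show ?thesis .
  qed
  ultimately show ?thesis using det_mult[of ?M ?N ?E] by simp
qed

text \<open>\<open>w\<close> labels \<open>m + n\<close> positions by letters. Exchanges are indexed
  by sets of positions instead of letters, because a letter in both rows has two copies that move
  independently.\<close>

definition split_minor :: "nat \<Rightarrow> nat \<Rightarrow> nat \<Rightarrow> nat \<Rightarrow> (nat \<Rightarrow> 'a) \<Rightarrow> nat set \<Rightarrow> ('a, 'k::comm_ring_1) lpoly" where
  "split_minor m n p p' w = split_det m n (\<lambda>r c. lpvar (w r) (p + c)) (\<lambda>r c. lpvar (w r) (p' + c))"

lemma det_two_blocks_lpvar:
  "det (mat (m + n) (m + n) (\<lambda>(r, c). if c < m then \<alpha> r * lpvar (w r) (p + c)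
      else \<beta> r * lpvar (w r) (p' + (c - m)))) =
    (\<Sum>S\<in>Pow {0..<m + n}. (\<Prod>r\<in>S. \<alpha> r) * (\<Prod>r\<in>{0..<m + n} - S. \<beta> r) * split_minor m n p p' w S)"
  unfolding split_minor_def
  by (rule det_two_blocks[where f = "\<lambda>r c. lpvar (w r) (p + c)" and g = "\<lambda>r c. lpvar (w r) (p' + c)"])

text \<open>Every column index of the second block occurs in the first. Expanding with weight
  \<open>0\<close> on \<open>V\<close> in the first block and on \<open>F\<close> in the second
  leaves the sets \<open>S\<close> that avoid \<open>V\<close> and contain \<open>F\<close>. After
  the column subtraction the second weight is \<open>0\<close> on \<open>E\<close>, so the same
  determinant is a sum over sets that avoid \<open>V\<close> and contain \<open>E\<close>. The set
  \<open>{0..<m}\<close> has coefficient \<open>1\<close> in the first sum and is absent from the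
  second.\<close>

lemma split_minor_exchange_nested:
  fixes w :: "nat \<Rightarrow> 'a"
  assumes "p \<le> p'" "p' + n \<le> p + m"
    and part: "F \<union> E \<union> V = {0..<m + n}" "F \<inter> E = {}" "F \<inter> V = {}" "E \<inter> V = {}"
    and F: "F \<subseteq> {0..<m}" and V: "V \<inter> {0..<m} = {}" and E: "\<not> E \<subseteq> {0..<m}"
  shows "(split_minor m n p p' w {0..<m} :: ('a, 'k::comm_ring_1) lpoly) \<in>
    lpm.span {split_minor m n p p' w S | S. S \<subseteq> {0..<m + n} \<and> card S = m \<and> S \<noteq> {0..<m} \<and>
      V \<inter> S = {} \<and> (F \<subseteq> S \<or> E \<subseteq> S)}" (is "_ \<in> lpm.span ?T")
proof -
  let ?U = "{0..<m + n}" and ?S0 = "{0..<m}"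
  let ?sm = "split_minor m n p p' w :: nat set \<Rightarrow> ('a, 'k) lpoly"
  let ?\<alpha> = "\<lambda>r. of_bool (r \<notin> V) :: ('a, 'k) lpoly" and ?\<beta> = "\<lambda>r. of_bool (r \<notin> F) :: ('a, 'k) lpoly"
  let ?c = "\<lambda>\<beta> S. (\<Prod>r\<in>S. ?\<alpha> r) * (\<Prod>r\<in>?U - S. \<beta> r)"
  let ?\<beta>' = "\<lambda>r. ?\<beta> r - ?\<alpha> r"
  have fin: "finite S" if "S \<subseteq> ?U" for S using that by (rule finite_subset) simp
  have unit: "?c \<beta> S \<in> {0, 1, -1}" if "\<beta> \<in> {?\<beta>, ?\<beta>'}" for S \<beta>
  proof -
    have "(\<Prod>r\<in>S. ?\<alpha> r) \<in> {0, 1, -1}" "(\<Prod>r\<in>?U - S. \<beta> r) \<in> {0, 1, -1}"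
      using that by (intro prod_in_units_or_zero; auto)+
    then show ?thesis by auto
  qed
  have eq1: "(\<Sum>S\<in>Pow ?U. ?c ?\<beta> S * ?sm S) = (\<Sum>S\<in>Pow ?U. ?c ?\<beta>' S * ?sm S)"
  proof -
    have "mat (m + n) (m + n) (\<lambda>(r, c). if c < m then ?\<alpha> r * lpvar (w r) (p + c)
        else (?\<beta> r - ?\<alpha> r * of_bool (p \<le> p' + (c - m) \<and> p' + (c - m) < p + m)) * lpvar (w r) (p' + (c - m))) =
      mat (m + n) (m + n) (\<lambda>(r, c). if c < m then ?\<alpha> r * lpvar (w r) (p + c)
        else ?\<beta>' r * lpvar (w r) (p' + (c - m)))"
      using assms(1,2) by (intro eq_matI) auto
    then show ?thesis
      using det_subtract_columns[of m n ?\<alpha> "\<lambda>r. lpvar (w r)" p ?\<beta> p']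
      by (simp only: det_two_blocks_lpvar)
  qed
  have eq2: "(\<Sum>S\<in>Pow ?U. ?c ?\<beta> S * ?sm S) = ?c ?\<beta> ?S0 * ?sm ?S0 + (\<Sum>S\<in>Pow ?U - {?S0}. ?c ?\<beta> S * ?sm S)"
    by (rule sum.remove) auto
  have eq3: "?c ?\<beta> ?S0 = 1"
    using V F by (subst (1 2) prod.neutral) auto
  have eq: "?sm ?S0 = (\<Sum>S\<in>Pow ?U. ?c ?\<beta>' S * ?sm S) - (\<Sum>S\<in>Pow ?U - {?S0}. ?c ?\<beta> S * ?sm S)"
    using trans[OF eq2[symmetric] eq1] by (simp only: eq3 mult_1_left eq_diff_eq)
  have "?c \<beta> S * ?sm S \<in> lpm.span ?T"
    if S: "S \<subseteq> ?U" and \<beta>: "\<beta> = ?\<beta>' \<or> \<beta> = ?\<beta> \<and> S \<noteq> ?S0" for S \<beta>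
  proof (rule span_scale_unit_or_zero)
    show "?c \<beta> S \<in> {0, 1, -1}" using \<beta> by (intro unit) auto
    assume nz: "?c \<beta> S \<noteq> 0"
    have "V \<inter> S = {}"
    proof (rule ccontr)
      assume "V \<inter> S \<noteq> {}"
      then have "(\<Prod>r\<in>S. ?\<alpha> r) = 0" using fin[OF S] by (intro prod_zero) auto
      then show False using nz by (simp only: mult_zero_left simp_thms)
    qed
    moreover have nz': "\<beta> r \<noteq> 0" if "r \<in> ?U - S" for r
    proof
      assume "\<beta> r = 0"
      then have "(\<Prod>r\<in>?U - S. \<beta> r) = 0" using that by (intro prod_zero) auto
      then show False using nz by (simp only: mult_zero_right simp_thms)
    qed
    moreover have "(F \<subseteq> S \<or> E \<subseteq> S) \<and> S \<noteq> ?S0"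
    proof (cases "\<beta> = ?\<beta>'")
      case True
      \<comment> \<open>On \<open>E\<close> both original weights are \<open>1\<close>, so their
        difference kills each term that leaves a row of \<open>E\<close> in the second
        block.\<close>
      have "E \<subseteq> S"
      proof
        fix r assume "r \<in> E"
        then have "\<beta> r = 0" "r \<in> ?U" using True part by auto
        then show "r \<in> S" using nz' by blast
      qed
      then show ?thesis using E by auto
    next
      case False
      then have b: "\<beta> = ?\<beta>" "S \<noteq> ?S0" using \<beta> by auto
      have "F \<subseteq> S"
      proof
        fix r assume "r \<in> F"
        then have "\<beta> r = 0" "r \<in> ?U" using b part by auto
        then show "r \<in> S" using nz' by blast
      qed
      then show ?thesis using b by auto
    qed
    ultimately show "?sm S \<in> lpm.span ?T"
    proof (cases "card S = m")
      case True
      then show ?thesis using \<open>V \<inter> S = {}\<close> \<open>(F \<subseteq> S \<or> E \<subseteq> S) \<and> S \<noteq> ?S0\<close> S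
        by (intro lpm.span_base) blast
    next
      case False
      then have "?sm S = 0" unfolding split_minor_def by (rule split_det_wrong_card)
      then show ?thesis using lpm.span_zero by (simp only:)
    qed
  qed
  then show ?thesis unfolding eq by (intro lpm.span_diff lpm.span_sum) auto
qed

text \<open>After the column subtraction the rows in \<open>E\<close> vanish in every column of the
  second block whose index is at least \<open>p\<close>. Only the \<open>m\<close> columns of the
  first block and at most \<open>p - p'\<close> further ones remain for them, so the determinant is
  zero and the terms containing \<open>F\<close> satisfy a linear relation.\<close>

lemma split_minor_exchange_skew:
  fixes w :: "nat \<Rightarrow> 'a"
  assumes "p' \<le> p" "p' + n \<le> p + m"
    and part: "F \<union> E \<union> V = {0..<m + n}" "F \<inter> E = {}" "F \<inter> V = {}" "E \<inter> V = {}"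
    and F: "F \<subseteq> {0..<m}" and V: "V \<inter> {0..<m} = {}" and E: "p + m - p' < card E"
  shows "(split_minor m n p p' w {0..<m} :: ('a, 'k::comm_ring_1) lpoly) \<in>
    lpm.span {split_minor m n p p' w S | S. S \<subseteq> {0..<m + n} \<and> card S = m \<and> S \<noteq> {0..<m} \<and>
      V \<inter> S = {} \<and> F \<subseteq> S}" (is "_ \<in> lpm.span ?T")
proof -
  let ?U = "{0..<m + n}" and ?S0 = "{0..<m}"
  let ?sm = "split_minor m n p p' w :: nat set \<Rightarrow> ('a, 'k) lpoly"
  let ?\<alpha> = "\<lambda>r. of_bool (r \<notin> V) :: ('a, 'k) lpoly" and ?\<beta> = "\<lambda>r. of_bool (r \<notin> F) :: ('a, 'k) lpoly"
  let ?c = "\<lambda>S. (\<Prod>r\<in>S. ?\<alpha> r) * (\<Prod>r\<in>?U - S. ?\<beta> r)"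
  have fin: "finite S" if "S \<subseteq> ?U" for S using that by (rule finite_subset) simp
  have unit: "?c S \<in> {0, 1, -1}" for S
  proof -
    have "(\<Prod>r\<in>S. ?\<alpha> r) \<in> {0, 1, -1}" "(\<Prod>r\<in>?U - S. ?\<beta> r) \<in> {0, 1, -1}"
      by (intro prod_in_units_or_zero; auto)+
    then show ?thesis by auto
  qed
  have eq1: "(\<Sum>S\<in>Pow ?U. ?c S * ?sm S) = 0"
  proof -
    let ?M = "mat (m + n) (m + n) (\<lambda>(r, c). if c < m then ?\<alpha> r * lpvar (w r) (p + c)
        else (?\<beta> r - ?\<alpha> r * of_bool (p \<le> p' + (c - m) \<and> p' + (c - m) < p + m)) * lpvar (w r) (p' + (c - m)))"
    have "det ?M = 0"
    proof (rule det_zero_pigeonhole)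
      show "E \<subseteq> {0..<m + n}" using part by blast
      show "card {0..<p + m - p'} < card E" using E by simp
      show "?M $$ (r, c) = 0" if "r \<in> E" "c < m + n" "c \<notin> {0..<p + m - p'}" for r c
      proof -
        have "r \<notin> F" "r \<notin> V" using that(1) part by auto
        moreover have "\<not> c < m" "p \<le> p' + (c - m)" "p' + (c - m) < p + m"
          using that(2,3) assms(1,2) by auto
        moreover have "r < m + n" using that(1) part by auto
        ultimately show ?thesis using that(2) by simp
      qed
    qed auto
    then show ?thesis
      using det_subtract_columns[of m n ?\<alpha> "\<lambda>r. lpvar (w r)" p ?\<beta> p']
      by (simp only: det_two_blocks_lpvar)
  qed
  have eq2: "(\<Sum>S\<in>Pow ?U. ?c S * ?sm S) = ?c ?S0 * ?sm ?S0 + (\<Sum>S\<in>Pow ?U - {?S0}. ?c S * ?sm S)"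
    by (rule sum.remove) auto
  have eq3: "?c ?S0 = 1"
    using V F by (subst (1 2) prod.neutral) auto
  have eq: "?sm ?S0 = - (\<Sum>S\<in>Pow ?U - {?S0}. ?c S * ?sm S)"
    using trans[OF eq2[symmetric] eq1] by (simp only: eq3 mult_1_left eq_neg_iff_add_eq_0)
  have "?c S * ?sm S \<in> lpm.span ?T" if S: "S \<subseteq> ?U" "S \<noteq> ?S0" for S
  proof (rule span_scale_unit_or_zero[OF unit])
    assume nz: "?c S \<noteq> 0"
    have "V \<inter> S = {}"
    proof (rule ccontr)
      assume "V \<inter> S \<noteq> {}"
      then have "(\<Prod>r\<in>S. ?\<alpha> r) = 0" using fin[OF S(1)] by (intro prod_zero) auto
      then show False using nz by (simp only: mult_zero_left simp_thms)
    qed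
    moreover have "F \<subseteq> S"
    proof (rule ccontr)
      assume "\<not> F \<subseteq> S"
      then have "(\<Prod>r\<in>?U - S. ?\<beta> r) = 0" using part by (intro prod_zero) auto
      then show False using nz by (simp only: mult_zero_right simp_thms)
    qed
    ultimately show "?sm S \<in> lpm.span ?T"
    proof (cases "card S = m")
      case True
      then show ?thesis using \<open>V \<inter> S = {}\<close> \<open>F \<subseteq> S\<close> S by (intro lpm.span_base) blast
    next
      case False
      then have "?sm S = 0" unfolding split_minor_def by (rule split_det_wrong_card)
      then show ?thesis using lpm.span_zero by (simp only:)
    qed
  qed
  then show ?thesis unfolding eq by (intro lpm.span_neg lpm.span_sum) auto
qed

lemma span_subst:
  assumes "f \<in> lpm.span A" "\<And>x. x \<in> A \<Longrightarrow> x \<in> lpm.span B"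
  shows "f \<in> lpm.span B"
proof -
  have "lpm.span A \<subseteq> lpm.span B" using assms(2) by (intro lpm.span_minimal lpm.subspace_span) blast
  then show ?thesis using assms(1) by blast
qed

section \<open>From Laplace terms to products of two minors\<close>

lemma minor_eq_det:
  fixes X :: "'a::linorder set"
  assumes "finite X" "card X = m"
  shows "\<exists>e\<in>{1, -1}. det (mat m m (\<lambda>(r, c). lpvar (sorted_list_of_set X ! r) (p + c))) =
    e * (minor p X :: ('a, 'k::comm_ring_1) lpoly)"
proof -
  let ?e = "(- 1) ^ (m choose 2) :: ('a, 'k) lpoly"
  let ?d = "det (mat m m (\<lambda>(r, c). lpvar (sorted_list_of_set X ! r) (p + c))) :: ('a, 'k) lpoly"
  have "mat m m (\<lambda>(r, s). lpvar (sorted_list_of_set X ! r) ([p..<p + card X] ! s)) =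
      (mat m m (\<lambda>(r, c). lpvar (sorted_list_of_set X ! r) (p + c)) :: ('a, 'k) lpoly mat)"
    using assms by (intro eq_matI) auto
  then have "minor p X = ?e * ?d"
    using assms by (simp add: minor_def biproduct_def Let_def)
  then have "?d = ?e * minor p X"
    by (simp only: mult.assoc[symmetric] power_add[symmetric] mult_2[symmetric] power_mult) simp
  then show ?thesis using minus_one_power_cases by (rule bexI)
qed

lemma mult_unit_cases: "e \<in> {1, -1} \<Longrightarrow> e' \<in> {1, -1} \<Longrightarrow> e * e' \<in> {1, -1 :: 'r::ring_1}"
  by auto

text \<open>Each letter is tagged with the block it goes to, so that a matrix row depends on the
  tagged letter only. A repeated tagged letter gives two equal rows. Without repetition, sorting the
  tagged letters makes the matrix block diagonal, at the cost of a sign.\<close>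

lemma split_minor_cases:
  fixes w :: "nat \<Rightarrow> 'a::linorder"
  assumes S: "S \<subseteq> {0..<m + n}" "card S = m"
  shows "(split_minor m n p p' w S :: ('a, 'k::idom) lpoly) = 0 \<or>
    inj_on w S \<and> inj_on w ({0..<m + n} - S) \<and>
    (\<exists>e\<in>{1, -1}. split_minor m n p p' w S = e * (minor p (w ` S) * minor p' (w ` ({0..<m + n} - S)) :: ('a, 'k) lpoly))"
    (is "?s = 0 \<or> _")
    and "inj_on w S \<Longrightarrow> inj_on w ({0..<m + n} - S) \<Longrightarrow> \<exists>e\<in>{1, -1}.
      split_minor m n p p' w S = e * (minor p (w ` S) * minor p' (w ` ({0..<m + n} - S)) :: ('a, 'k) lpoly)"
proof -
  let ?N = "m + n"
  let ?U = "{0..<?N}"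
  define h :: "'a \<times> bool \<Rightarrow> nat \<Rightarrow> ('a, 'k) lpoly" where
    "h = (\<lambda>(a, b) c. if c < m then (if b then lpvar a (p + c) else 0)
       else (if b then 0 else lpvar a (p' + (c - m))))"
  define R where "R = map (\<lambda>r. (w r, r \<in> S)) [0..<?N]"
  let ?M = "mat ?N ?N (\<lambda>(r, c). h (R ! r) c)"
  have lenR: "length R = ?N" unfolding R_def by simp
  have "?s = det (mat ?N ?N (\<lambda>(r, c). if c < m then (if r \<in> S then lpvar (w r) (p + c) else 0)
      else (if r \<in> S then 0 else lpvar (w r) (p' + (c - m)))))"
    unfolding split_minor_def by (rule split_det_eq_det[OF S(1)])
  also have "\<dots> = det ?M"
    by (rule arg_cong[of _ _ det], rule eq_matI) (auto simp: h_def R_def)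
  finally have s: "?s = det ?M" .
  have zero: "?s = 0" if "\<not> (inj_on w S \<and> inj_on w (?U - S))"
  proof -
    from that obtain i j where ij: "i \<in> ?U" "j \<in> ?U" "i \<noteq> j" "w i = w j" "i \<in> S \<longleftrightarrow> j \<in> S"
      using S(1) unfolding inj_on_def by blast
    have "det ?M = 0"
    proof (rule det_identical_rows[of _ ?N i j])
      have "R ! i = R ! j" using ij by (simp add: R_def)
      then show "row ?M i = row ?M j" using ij by (intro eq_vecI) auto
    qed (use ij in auto)
    then show ?thesis using s by simp
  qed
  show nonzero: "\<exists>e\<in>{1, -1}. ?s = e * (minor p (w ` S) * minor p' (w ` (?U - S)))"
    if inj: "inj_on w S" "inj_on w (?U - S)"
  proof -
    have fin: "finite S" "finite (?U - S)" using S(1) finite_subset by auto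
    have cards: "card (w ` S) = m" "card (w ` (?U - S)) = n"
      using inj S fin by (simp_all add: card_image card_Diff_subset)
    define xs where "xs = sorted_list_of_set (w ` S)"
    define ys where "ys = sorted_list_of_set (w ` (?U - S))"
    define R' where "R' = map (\<lambda>a. (a, True)) xs @ map (\<lambda>a. (a, False)) ys"
    have len: "length xs = m" "length ys = n" using cards by (simp_all add: xs_def ys_def)
    have sets: "set xs = w ` S" "set ys = w ` (?U - S)" using fin by (simp_all add: xs_def ys_def)
    have dist: "distinct xs" "distinct ys" by (simp_all add: xs_def ys_def)
    have "distinct R"
      unfolding R_def distinct_map
    proof
      show "inj_on (\<lambda>r. (w r, r \<in> S)) (set [0..<?N])"
      proof (rule inj_onI)
        fix r r' assume "r \<in> set [0..<?N]" "r' \<in> set [0..<?N]" "(w r, r \<in> S) = (w r', r' \<in> S)"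
        then show "r = r'" using inj_onD[OF inj(1), of r r'] inj_onD[OF inj(2), of r r'] by auto
      qed
    qed simp
    moreover have "distinct R'"
      using dist unfolding R'_def by (auto simp: distinct_map intro: inj_onI)
    moreover have "set R = set R'"
    proof -
      have "set R = (\<lambda>r. (w r, r \<in> S)) ` (S \<union> (?U - S))"
        using S(1) by (simp add: R_def Un_absorb1)
      also have "\<dots> = (\<lambda>a. (a, True)) ` w ` S \<union> (\<lambda>a. (a, False)) ` w ` (?U - S)"
        unfolding image_Un image_image by (intro arg_cong2[of _ _ _ _ "(\<union>)"] image_cong) auto
      finally show ?thesis by (simp add: R'_def sets)
    qed
    ultimately have "mset R = mset R'" by (simp add: set_eq_iff_mset_eq_distinct)
    moreover have lenR': "length R' = ?N" using len by (simp add: R'_def)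
    ultimately obtain e0 where e0: "e0 \<in> {1, -1}"
      "det ?M = e0 * det (mat ?N ?N (\<lambda>(r, c). h (R' ! r) c))"
      using bexE[OF det_mset_rows[of R R' h, unfolded lenR lenR']] by metis
    let ?A = "mat m m (\<lambda>(r, c). lpvar (xs ! r) (p + c)) :: ('a, 'k) lpoly mat"
    let ?B = "mat n n (\<lambda>(r, c). lpvar (ys ! r) (p' + c)) :: ('a, 'k) lpoly mat"
    have "mat ?N ?N (\<lambda>(r, c). h (R' ! r) c) = four_block_mat ?A (0\<^sub>m m n) (0\<^sub>m n m) ?B"
    proof (rule eq_matI, goal_cases)
      case (1 i j)
      then show ?case using len by (auto simp: h_def R'_def nth_append)
    qed auto
    then have "det (mat ?N ?N (\<lambda>(r, c). h (R' ! r) c)) = det ?A * det ?B"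
      using det_four_block_mat_upper_right_zero[of ?A m "0\<^sub>m m n" n "0\<^sub>m n m" ?B] by simp
    moreover obtain e1 where e1: "e1 \<in> {1, -1}" "det ?A = e1 * minor p (w ` S)"
      using minor_eq_det[of "w ` S" m p] fin cards unfolding xs_def by blast
    moreover obtain e2 where e2: "e2 \<in> {1, -1}" "det ?B = e2 * minor p' (w ` (?U - S))"
      using minor_eq_det[of "w ` (?U - S)" n p'] fin cards unfolding ys_def by blast
    ultimately have "?s = (e0 * (e1 * e2)) * (minor p (w ` S) * minor p' (w ` (?U - S)))"
      using s e0 by (simp only: mult_ac)
    moreover have "e0 * (e1 * e2) \<in> {1, -1}"
      using e0(1) e1(1) e2(1) by (intro mult_unit_cases)
    ultimately show ?thesis by (rule bexI)
  qed
  show "?s = 0 \<or> inj_on w S \<and> inj_on w (?U - S) \<and>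
    (\<exists>e\<in>{1, -1}. ?s = e * (minor p (w ` S) * minor p' (w ` (?U - S))))"
    using zero nonzero by blast
qed

section \<open>Straightening two rows\<close>

text \<open>The column in which \<open>t\<close> is or would be inserted in a row starting in column \<open>p\<close> with set of
  entries \<open>u\<close>. In these terms a pair of rows violates straightness at an entry \<open>t\<close> of the lower row
  if \<open>t\<close> would be inserted in the upper row in its own column.\<close>

definition insert_col :: "nat \<Rightarrow> 'a::linorder set \<Rightarrow> 'a \<Rightarrow> nat" where
  "insert_col p u t = p + card {y \<in> u. y < t}"

definition straight_pair :: "nat \<Rightarrow> 'a::linorder set \<Rightarrow> nat \<Rightarrow> 'a set \<Rightarrow> bool" where
  "straight_pair p u p' v \<longleftrightarrow> (\<forall>t \<in> v - u. insert_col p' v t \<noteq> insert_col p u t)"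

text \<open>Compares subsets of \<open>Z\<close> by the largest letter in which they differ.
  Encoding this comparison in a natural number reduces termination to induction on
  \<open>nat\<close>.\<close>

definition binary_weight :: "'a::linorder set \<Rightarrow> 'a set \<Rightarrow> nat" where
  "binary_weight Z K = (\<Sum>z\<in>K. 2 ^ card {y \<in> Z. y < z})"

lemma binary_weight_less:
  fixes Z :: "'a::linorder set"
  assumes Z: "finite Z" and K: "K \<subseteq> Z" "K' \<subseteq> Z" and t: "t \<in> K" "t \<notin> K'"
    and above: "\<And>s. s \<in> Z \<Longrightarrow> t < s \<Longrightarrow> s \<in> K \<longleftrightarrow> s \<in> K'"
  shows "binary_weight Z K' < binary_weight Z K"
proof -
  let ?r = "\<lambda>z. card {y \<in> Z. y < z}"
  have fin: "finite K" "finite K'" using K Z finite_subset by auto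
  have mono: "?r y < ?r z" if "y \<in> Z" "y < z" for y z
    using that Z by (intro psubset_card_mono) auto
  have inj: "inj_on ?r Z"
  proof (rule inj_onI)
    fix y z assume yz: "y \<in> Z" "z \<in> Z" "?r y = ?r z"
    then show "y = z" using mono[of y z] mono[of z y] by (cases y z rule: linorder_cases) auto
  qed
  have split: "sum (\<lambda>z. 2 ^ ?r z) A = (\<Sum>z\<in>{z \<in> A. t < z}. 2 ^ ?r z) + (\<Sum>z\<in>{z \<in> A. \<not> t < z}. (2::nat) ^ ?r z)"
    if "finite A" for A
    using that by (subst sum.union_disjoint[symmetric]) (auto intro!: sum.cong)
  have geometric: "(\<Sum>i<k. 2 ^ i) < (2::nat) ^ k" for k by (induction k) auto
  \<comment> \<open>By the geometric sum, all digits of \<open>K'\<close> below that of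
    \<open>t\<close> together stay below the single digit that \<open>t\<close> contributes to
    \<open>K\<close>.\<close>
  have "(\<Sum>z\<in>{z \<in> K'. \<not> t < z}. (2::nat) ^ ?r z) = (\<Sum>i\<in>?r ` {z \<in> K'. \<not> t < z}. 2 ^ i)"
    using K(2) by (subst sum.reindex) (auto intro: inj_on_subset[OF inj])
  also have "\<dots> \<le> (\<Sum>i<?r t. 2 ^ i)"
    using K(2) t mono by (intro sum_mono2) (auto simp: not_less order_le_less)
  also have "\<dots> < 2 ^ ?r t"
    using geometric[of "?r t"] .
  also have "\<dots> \<le> (\<Sum>z\<in>{z \<in> K. \<not> t < z}. 2 ^ ?r z)"
    using fin t by (intro member_le_sum) auto
  finally have "(\<Sum>z\<in>{z \<in> K'. \<not> t < z}. (2::nat) ^ ?r z) < (\<Sum>z\<in>{z \<in> K. \<not> t < z}. 2 ^ ?r z)" .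
  moreover have "{z \<in> K. t < z} = {z \<in> K'. t < z}" using above K by auto
  ultimately show ?thesis unfolding binary_weight_def split[OF fin(1)] split[OF fin(2)] by simp
qed

text \<open>Read the letters from the largest downwards. If the upper row starts strictly to the right of
  the lower one, an exchange moves the largest affected letter out of the upper row. Otherwise it
  moves that letter out of the upper row if no larger letter \<open>s\<close> has a smaller insertion column in the
  upper row than in the lower row, and into the upper row if there is such an \<open>s\<close>. Either way the
  letter leaves the following set, whose part above that letter is unchanged.\<close>

definition exchange_key :: "nat \<Rightarrow> 'a::linorder set \<Rightarrow> nat \<Rightarrow> 'a set \<Rightarrow> 'a set" where
  "exchange_key p u p' v = (if p \<le> p'
     then {z \<in> u \<union> v. if \<exists>s\<in>u \<union> v. z < s \<and> insert_col p u s < insert_col p' v s then z \<in> v else z \<in> u}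
     else u)"

lemma insert_col_less_split:
  assumes "finite u" "s \<le> t"
  shows "insert_col p u t = insert_col p u s + card {y \<in> u. s \<le> y \<and> y < t}"
proof -
  have "{y \<in> u. y < t} = {y \<in> u. y < s} \<union> {y \<in> u. s \<le> y \<and> y < t}" using assms(2) by auto
  moreover have "card ({y \<in> u. y < s} \<union> {y \<in> u. s \<le> y \<and> y < t}) =
      card {y \<in> u. y < s} + card {y \<in> u. s \<le> y \<and> y < t}"
    using assms(1) by (intro card_Un_disjoint) auto
  ultimately have "card {y \<in> u. y < t} = card {y \<in> u. y < s} + card {y \<in> u. s \<le> y \<and> y < t}"
    by simp
  then show ?thesis by (simp add: insert_col_def)
qed

text \<open>Rows of equal size that agree from \<open>s\<close> upwards have equally many letters
  below \<open>s\<close>, whatever these are. So an exchange among smaller letters does not shift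
  the insertion column of \<open>s\<close>.\<close>

lemma insert_col_cong_above:
  assumes "finite u" "finite u'" "card u' = card u" "\<And>y. s \<le> y \<Longrightarrow> y \<in> u' \<longleftrightarrow> y \<in> u"
  shows "insert_col p u' s = insert_col p u s"
proof -
  have split: "card {y \<in> x. y < s} = card x - card {y \<in> x. s \<le> y}" if "finite x" for x
  proof -
    have "x = {y \<in> x. y < s} \<union> {y \<in> x. s \<le> y}" by auto
    then have "card x = card {y \<in> x. y < s} + card {y \<in> x. s \<le> y}"
      using that by (metis (no_types, lifting) card_Un_disjoint disjoint_iff finite_Un leD mem_Collect_eq)
    then show ?thesis by simp
  qed
  have "{y \<in> u'. s \<le> y} = {y \<in> u. s \<le> y}" using assms(4) by auto
  then show ?thesis using split assms by (simp add: insert_col_def)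
qed

text \<open>No letter above \<open>t\<close> changes rows, so insertion columns above
  \<open>t\<close> are unchanged, and so is the choice between \<open>u\<close> and \<open>v\<close>
  that the key makes at \<open>t\<close> and above. Hence the keys agree above \<open>t\<close>,
  while \<open>t\<close>, present in one row only, switches rows and drops out of the key.\<close>

lemma exchange_key_weight_less:
  fixes u v u' v' :: "'a::linorder set"
  assumes fin: "finite u" "finite v"
    and content: "u' \<union> v' = u \<union> v" "u' \<inter> v' = u \<inter> v"
    and cards: "card u' = card u" "card v' = card v"
    and above: "\<And>s. t < s \<Longrightarrow> s \<in> u' \<longleftrightarrow> s \<in> u"
    and t: "t \<in> exchange_key p u p' v"
      "t \<in> u \<longleftrightarrow> t \<notin> u'"
      "t \<in> u \<longleftrightarrow> t \<notin> v"
  shows "binary_weight (u \<union> v) (exchange_key p u' p' v') < binary_weight (u \<union> v) (exchange_key p u p' v)"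
proof -
  have fin': "finite u'" "finite v'" using fin content(1) by (metis finite_Un)+
  have above_v: "s \<in> v' \<longleftrightarrow> s \<in> v" if "t < s" for s using above[OF that] content by blast
  have cols: "insert_col p u' s = insert_col p u s" "insert_col p' v' s = insert_col p' v s" if "t < s" for s
    using that above above_v fin fin' cards by (intro insert_col_cong_above; auto)+
  have phase: "(\<exists>s\<in>u' \<union> v'. z < s \<and> insert_col p u' s < insert_col p' v' s) \<longleftrightarrow>
      (\<exists>s\<in>u \<union> v. z < s \<and> insert_col p u s < insert_col p' v s)" if "t \<le> z" for z
    using cols content(1) that by (intro bex_cong) auto
  have sub: "exchange_key p u p' v \<subseteq> u \<union> v" "exchange_key p u' p' v' \<subseteq> u \<union> v"
    using content(1) by (auto simp: exchange_key_def)
  have swap: "t \<in> v' \<longleftrightarrow> t \<notin> v" "t \<in> u' \<longleftrightarrow> t \<notin> u" using t content sub by blast+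
  show ?thesis
  proof (rule binary_weight_less[where t = t])
    show "t \<notin> exchange_key p u' p' v'"
      using t(1,3) swap phase[of t] content(1) unfolding exchange_key_def by (auto split: if_splits)
    show "s \<in> exchange_key p u p' v \<longleftrightarrow> s \<in> exchange_key p u' p' v'" if "s \<in> u \<union> v" "t < s" for s
      using that above above_v phase[of s] content(1) unfolding exchange_key_def by (auto split: if_splits)
  qed (use fin sub t in auto)
qed

section \<open>Exchanging letters between two rows\<close>

lemma index_exchange_content:
  fixes w :: "nat \<Rightarrow> 'a"
  assumes "inj_on w {0..<m}" "w ` {0..<m} = u" "inj_on w {m..<m + n}" "w ` {m..<m + n} = v"
    and "S \<subseteq> {0..<m + n}" "inj_on w S" "inj_on w ({0..<m + n} - S)"
  shows "w ` S \<union> w ` ({0..<m + n} - S) = u \<union> v" "w ` S \<inter> w ` ({0..<m + n} - S) = u \<inter> v"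
proof -
  have U: "{0..<m + n} = {0..<m} \<union> {m..<m + n}" by auto
  have "w ` S \<union> w ` ({0..<m + n} - S) = w ` {0..<m + n}" using assms(5) by blast
  then show "w ` S \<union> w ` ({0..<m + n} - S) = u \<union> v" using assms(2,4) U by (simp add: image_Un)
  \<comment> \<open>A letter lies in both parts exactly when it labels two different positions. This
    criterion depends only on the union of the two position sets, which the exchange
    preserves.\<close>
  have two: "z \<in> w ` A \<inter> w ` B \<longleftrightarrow> (\<exists>r r'. r \<in> A \<union> B \<and> r' \<in> A \<union> B \<and> r \<noteq> r' \<and> w r = z \<and> w r' = z)"
    if "A \<inter> B = {}" "inj_on w A" "inj_on w B" for z A B
  proof
    assume "z \<in> w ` A \<inter> w ` B"
    then obtain r r' where "r \<in> A" "r' \<in> B" "w r = z" "w r' = z" by auto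
    moreover from this have "r \<noteq> r'" using that(1) by auto
    ultimately show "\<exists>r r'. r \<in> A \<union> B \<and> r' \<in> A \<union> B \<and> r \<noteq> r' \<and> w r = z \<and> w r' = z"
      by (intro exI[of _ r] exI[of _ r']) simp
  next
    assume "\<exists>r r'. r \<in> A \<union> B \<and> r' \<in> A \<union> B \<and> r \<noteq> r' \<and> w r = z \<and> w r' = z"
    then obtain r r' where r: "r \<in> A \<union> B" "r' \<in> A \<union> B" "r \<noteq> r'" "w r = z" "w r' = z"
      by auto
    then have "r \<in> A \<and> r' \<in> B \<or> r \<in> B \<and> r' \<in> A"
      using inj_onD[OF that(2), of r r'] inj_onD[OF that(3), of r r'] by auto
    then show "z \<in> w ` A \<inter> w ` B" using r(4,5) by (elim disjE) (simp_all add: image_iff, metis+)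
  qed
  have US: "S \<union> ({0..<m + n} - S) = {0..<m} \<union> {m..<m + n}" using assms(5) U by auto
  have "w ` S \<inter> w ` ({0..<m + n} - S) = w ` {0..<m} \<inter> w ` {m..<m + n}"
  proof (rule Set.set_eqI)
    fix z
    have "{0..<m} \<inter> {m..<m + n} = {}" by auto
    from two[OF this assms(1,3), of z] two[OF _ assms(6,7), of z]
    show "z \<in> w ` S \<inter> w ` ({0..<m + n} - S) \<longleftrightarrow> z \<in> w ` {0..<m} \<inter> w ` {m..<m + n}"
      unfolding US by (simp only: Diff_disjoint simp_thms)
  qed
  then show "w ` S \<inter> w ` ({0..<m + n} - S) = u \<inter> v" by (simp only: assms(2,4))
qed

lemma obtain_index_letters:
  assumes "finite u" "finite v" "card u = m" "card v = n"
  obtains w :: "nat \<Rightarrow> 'a" where "inj_on w {0..<m}" "w ` {0..<m} = u" "inj_on w {m..<m + n}" "w ` {m..<m + n} = v"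
proof -
  obtain f g where f: "bij_betw f {0..<m} u" and g: "bij_betw g {0..<n} v"
    using assms ex_bij_betw_nat_finite by metis
  define w where "w r = (if r < m then f r else g (r - m))" for r
  have "bij_betw w {0..<m} u"
    using f by (rule bij_betw_cong[THEN iffD1, rotated]) (simp add: w_def)
  moreover have "bij_betw w {m..<m + n} v"
  proof -
    have "bij_betw (\<lambda>r. r - m) {m..<m + n} {0..<n}"
      by (rule bij_betw_byWitness[where f' = "\<lambda>r. r + m"]) auto
    then have "bij_betw (g \<circ> (\<lambda>r. r - m)) {m..<m + n} v" using g by (rule bij_betw_trans)
    then show ?thesis by (rule bij_betw_cong[THEN iffD1, rotated]) (simp add: w_def)
  qed
  ultimately show thesis using that[of w] unfolding bij_betw_def by blast
qed

text \<open>Union and intersection together fix the content of the two rows as a multiset.\<close>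

definition better_pairs :: "nat \<Rightarrow> 'a::linorder set \<Rightarrow> nat \<Rightarrow> 'a set \<Rightarrow> ('a set \<times> 'a set) set" where
  "better_pairs p u p' v = {(u', v'). u' \<union> v' = u \<union> v \<and> u' \<inter> v' = u \<inter> v \<and> card u' = card u \<and> card v' = card v \<and>
     binary_weight (u \<union> v) (exchange_key p u' p' v') < binary_weight (u \<union> v) (exchange_key p u p' v)}"

definition pair_minor :: "nat \<Rightarrow> nat \<Rightarrow> 'a::linorder set \<times> 'a set \<Rightarrow> ('a, 'k::comm_ring_1) lpoly" where
  "pair_minor p p' = (\<lambda>(u, v). minor p u * minor p' v)"

lemma split_minor_in_span:
  fixes w :: "nat \<Rightarrow> 'a::linorder"
  assumes "S \<subseteq> {0..<m + n}" "card S = m"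
    and "inj_on w S \<Longrightarrow> inj_on w ({0..<m + n} - S) \<Longrightarrow> (w ` S, w ` ({0..<m + n} - S)) \<in> Q"
  shows "(split_minor m n p p' w S :: ('a, 'k::idom) lpoly) \<in> lpm.span (pair_minor p p' ` Q)"
  using split_minor_cases(1)[OF assms(1,2), of p p' w, where ?'k = 'k]
proof (elim disjE conjE bexE)
  fix e :: "('a, 'k) lpoly"
  assume e: "e \<in> {1, -1}" and inj: "inj_on w S" "inj_on w ({0..<m + n} - S)"
    and eq: "split_minor m n p p' w S = e * (minor p (w ` S) * minor p' (w ` ({0..<m + n} - S)))"
  have "minor p (w ` S) * minor p' (w ` ({0..<m + n} - S)) \<in> lpm.span (pair_minor p p' ` Q)"
    by (rule lpm.span_base, rule image_eqI[OF _ assms(3)[OF inj]]) (simp add: pair_minor_def)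
  moreover have "e \<in> {0, 1, -1}" using e by (rule insertI2)
  ultimately show ?thesis unfolding eq by (rule span_scale_unit_or_zero[rotated])
next
  assume "split_minor m n p p' w S = (0 :: ('a, 'k) lpoly)"
  then show ?thesis using lpm.span_zero by (simp only:)
qed

text \<open>The sets \<open>F\<close>, \<open>E\<close> and \<open>V\<close> are chosen around an
  offending letter \<open>t0\<close> so that, in every term of the exchange identity, the largest
  letter that changes rows occurs in only one of them and leaves the exchange key.\<close>

lemma pair_exchange:
  fixes u v :: "'a::linorder set"
  assumes fin: "finite u" "finite v" and ends: "p' + card v \<le> p + card u"
    and nonstraight: "\<not> straight_pair p u p' v"
  shows "(pair_minor p p' (u, v) :: ('a, 'k::idom) lpoly) \<in> lpm.span (pair_minor p p' ` better_pairs p u p' v)"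
proof -
  define m n where "m = card u" and "n = card v"
  obtain w where w: "inj_on w {0..<m}" "w ` {0..<m} = u" "inj_on w {m..<m + n}" "w ` {m..<m + n} = v"
    using obtain_index_letters[OF fin] m_def n_def by metis
  let ?U = "{0..<m + n}" and ?S0 = "{0..<m}"
  let ?sm = "split_minor m n p p' w :: nat set \<Rightarrow> ('a, 'k) lpoly"
  let ?better = "lpm.span (pair_minor p p' ` better_pairs p u p' v) :: ('a, 'k) lpoly set"
  have UD: "?U - ?S0 = {m..<m + n}" by auto
  have wu: "w r \<in> u" if "r < m" for r using that w(2) by auto
  have wv: "w r \<in> v" if "m \<le> r" "r < m + n" for r using that w(4) by auto
  have content: "w ` S \<union> w ` (?U - S) = u \<union> v" "w ` S \<inter> w ` (?U - S) = u \<inter> v"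
    if "S \<subseteq> ?U" "inj_on w S" "inj_on w (?U - S)" for S
    using index_exchange_content[OF w that] by auto
  have better: "(w ` S, w ` (?U - S)) \<in> better_pairs p u p' v"
    if S: "S \<subseteq> ?U" "card S = m" "inj_on w S" "inj_on w (?U - S)"
      and above: "\<And>s. t < s \<Longrightarrow> s \<in> w ` S \<longleftrightarrow> s \<in> u"
      and t: "t \<in> exchange_key p u p' v" "t \<in> u \<longleftrightarrow> t \<notin> w ` S" "t \<in> u \<longleftrightarrow> t \<notin> v" for S t
  proof -
    have "card (?U - S) = n" using S finite_subset[OF S(1)] by (simp add: card_Diff_subset)
    then have cards: "card (w ` S) = card u" "card (w ` (?U - S)) = card v"
      using S by (simp_all add: card_image m_def n_def)
    show ?thesis
      unfolding better_pairs_def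
      using content[OF S(1,3,4)] cards exchange_key_weight_less[OF fin content[OF S(1,3,4)] cards above t]
      by simp
  qed
  have step: "?sm S \<in> ?better"
    if "S \<subseteq> ?U" "card S = m"
      and "inj_on w S \<Longrightarrow> inj_on w (?U - S) \<Longrightarrow> \<exists>t. (\<forall>s>t. s \<in> w ` S \<longleftrightarrow> s \<in> u) \<and>
        t \<in> exchange_key p u p' v \<and> (t \<in> u \<longleftrightarrow> t \<notin> w ` S) \<and> (t \<in> u \<longleftrightarrow> t \<notin> v)" for S
    using that better by (intro split_minor_in_span) blast+
  obtain t0 where t0: "t0 \<in> v" "t0 \<notin> u" "insert_col p' v t0 = insert_col p u t0"
    using nonstraight unfolding straight_pair_def by auto
  obtain r0 where r0: "m \<le> r0" "r0 < m + n" "w r0 = t0" using t0(1) w(4) by (metis atLeastLessThan_iff imageE)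
  have "?sm ?S0 \<in> ?better"
  proof (cases "p \<le> p'")
    case True
    \<comment> \<open>The maximum \<tau> of this set is where the exchange key switches: it consists
      of letters of \<open>v\<close> below \<tau> and of letters of \<open>u\<close> from \<tau>
      on.\<close>
    let ?A = "{s \<in> u \<union> v. insert_col p u s < insert_col p' v s}"
    define \<tau> where "\<tau> = Max ?A"
    have finA: "finite ?A" using fin by simp
    \<comment> \<open>As the lower row has a cell for \<open>t0\<close> and ends no further right
      than the upper one, the upper row has a letter above \<open>t0\<close>. At the first such
      letter the upper insertion column has not advanced since \<open>t0\<close>, but the lower one
      has, because of \<open>t0\<close> itself.\<close>
    have "\<exists>s\<in>?A. t0 < s"
    proof -
      have "card {y \<in> u. y < t0} < card u"
      proof -
        have "card {y \<in> v. y < t0} < card v"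
          using t0(1) fin by (intro psubset_card_mono) auto
        then show ?thesis using t0(3) ends unfolding insert_col_def by linarith
      qed
      then have "{y \<in> u. y < t0} \<noteq> u" by force
      then have ne: "{y \<in> u. t0 < y} \<noteq> {}" using t0(2) by (auto simp: not_less order_le_less)
      define s where "s = Min {y \<in> u. t0 < y}"
      have s: "s \<in> u" "t0 < s" using Min_in[OF _ ne] fin unfolding s_def by auto
      have le: "s \<le> y" if "y \<in> u" "t0 < y" for y using that fin unfolding s_def by (intro Min_le) auto
      have "{y \<in> u. t0 \<le> y \<and> y < s} = {}" using le t0(2) by (force simp: order_le_less)
      then have "insert_col p u s = insert_col p u t0"
        using insert_col_less_split[of u t0 s p] fin s by simp
      moreover have "0 < card {y \<in> v. t0 \<le> y \<and> y < s}" using t0(1) s fin by (auto simp: card_gt_0_iff)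
      then have "insert_col p' v t0 < insert_col p' v s"
        using insert_col_less_split[of v t0 s p'] fin s by simp
      ultimately show ?thesis using s t0(3) by auto
    qed
    then obtain s0 where "s0 \<in> ?A" "t0 < s0" by blast
    then have \<tau>: "\<tau> \<in> ?A" "t0 < \<tau>"
      using Max_in[OF finA] Max_ge[OF finA \<open>s0 \<in> ?A\<close>] unfolding \<tau>_def by (blast, simp)
    have max: "s \<le> \<tau>" if "s \<in> ?A" for s using that finA unfolding \<tau>_def by (intro Max_ge)
    \<comment> \<open>The insertion columns agree at \<open>t0\<close>, and the upper one has fallen
      behind at \<tau>.\<close>
    have count: "card {y \<in> u. t0 \<le> y \<and> y < \<tau>} < card {y \<in> v. t0 \<le> y \<and> y < \<tau>}"
      using \<tau> insert_col_less_split[of u t0 \<tau> p] insert_col_less_split[of v t0 \<tau> p'] fin t0(3) by simp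
    \<comment> \<open>Terms that keep \<open>F\<close> raise lower letters from \<open>t0\<close> up
      to but excluding \<tau>, in return for upper letters below \<open>t0\<close>. Terms that
      contain \<open>E\<close> raise all those lower letters, in return for upper letters from
      \<open>t0\<close> on.\<close>
    define F where "F = {r. r < m \<and> t0 \<le> w r}"
    define E where "E = {r. r < m \<and> w r < t0} \<union> {r. m \<le> r \<and> r < m + n \<and> t0 \<le> w r \<and> w r < \<tau>}"
    define V where "V = {r. m \<le> r \<and> r < m + n \<and> (w r < t0 \<or> \<tau> \<le> w r)}"
    have main: "?sm ?S0 \<in> lpm.span {?sm S | S. S \<subseteq> ?U \<and> card S = m \<and> S \<noteq> ?S0 \<and> V \<inter> S = {} \<and> (F \<subseteq> S \<or> E \<subseteq> S)}"
    proof (rule split_minor_exchange_nested[OF True])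
      show "p' + n \<le> p + m" using ends by (simp add: m_def n_def)
      show "\<not> E \<subseteq> {0..<m}" using r0 \<tau> unfolding E_def by auto
    qed (auto simp: F_def E_def V_def)
    have each: "?sm S \<in> ?better"
      if S: "S \<subseteq> ?U" "card S = m" "S \<noteq> ?S0" "V \<inter> S = {}" "F \<subseteq> S \<or> E \<subseteq> S" for S
    proof (rule step[OF S(1,2)])
      assume inj: "inj_on w S" "inj_on w (?U - S)"
      have finS: "finite S" using S(1) by (rule finite_subset) simp
      note content = content[OF S(1) inj]
      have S0: "card (?S0 - S) = card (S - ?S0)"
        using card_Diff_subset_Int[of ?S0 S] card_Diff_subset_Int[of S ?S0] S(2) finS
        by (simp add: Int_commute)
      show "\<exists>t. (\<forall>s>t. s \<in> w ` S \<longleftrightarrow> s \<in> u) \<and>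
        t \<in> exchange_key p u p' v \<and> (t \<in> u \<longleftrightarrow> t \<notin> w ` S) \<and> (t \<in> u \<longleftrightarrow> t \<notin> v)"
      proof (cases "F \<subseteq> S")
        \<comment> \<open>Letters going down are below \<open>t0\<close>, so the largest mover goes
          up. It is below \<tau>, where leaving \<open>v\<close> means leaving the key.\<close>
        case FS: True
        have ne: "w ` (S - ?S0) \<noteq> {}"
          using S(2,3) finS card_subset_eq[of ?S0 S] by auto
        define t where "t = Max (w ` (S - ?S0))"
        have "t \<in> w ` (S - ?S0)" unfolding t_def using ne finS by (intro Max_in) auto
        then obtain r where r: "r \<in> S" "m \<le> r" "r < m + n" "w r = t" using S(1) by force
        have le: "w r' \<le> t" if "r' \<in> S" "m \<le> r'" for r' unfolding t_def using finS that by (intro Max_ge) auto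
        have "r \<notin> V" using r S(4) by auto
        then have bounds: "t0 \<le> t" "t < \<tau>" using r unfolding V_def by auto
        have tv: "t \<in> v" using wv r by blast
        have tu: "t \<notin> u"
        proof
          assume "t \<in> u"
          then obtain r1 where r1: "r1 < m" "w r1 = t" using w(2) by force
          then have "r1 \<in> S" using FS bounds unfolding F_def by auto
          then show False using inj_onD[OF inj(1), of r r1] r r1 by auto
        qed
        have above: "s \<in> w ` S \<longleftrightarrow> s \<in> u" if "t < s" for s
        proof
          assume "s \<in> w ` S"
          then obtain r' where r': "r' \<in> S" "w r' = s" by auto
          then have "r' < m" using le[of r'] that by force
          then show "s \<in> u" using wu r' by auto
        next
          assume "s \<in> u"
          then obtain r' where r': "r' < m" "w r' = s" using w(2) by force
          then have "r' \<in> S" using FS bounds that unfolding F_def by auto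
          then show "s \<in> w ` S" using r' by auto
        qed
        have "t \<in> exchange_key p u p' v"
          using tv True bounds \<tau> unfolding exchange_key_def by auto
        moreover have "t \<in> w ` S" using r by auto
        ultimately show ?thesis using above tu tv by blast
      next
        case False
        then have ES: "E \<subseteq> S" using S(5) by simp
        have in_F: "r \<in> F" if "r < m" "r \<notin> S" for r
          using that ES unfolding E_def F_def by (auto simp: not_less)
        \<comment> \<open>By \<open>count\<close>, the upper letters from \<open>t0\<close> to below
          \<tau> are too few to replace all the lower letters that rise. So an upper letter at or
          above \<tau> must go down, and there leaving \<open>u\<close> means leaving the
          key.\<close>
        have "\<exists>r<m. r \<notin> S \<and> \<tau> \<le> w r"
        proof (rule ccontr)
          assume "\<not> (\<exists>r<m. r \<notin> S \<and> \<tau> \<le> w r)"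
          then have "w ` (?S0 - S) \<subseteq> {y \<in> u. t0 \<le> y \<and> y < \<tau>}"
            using in_F wu unfolding F_def by (auto simp: not_le)
          then have "card (w ` (?S0 - S)) \<le> card {y \<in> u. t0 \<le> y \<and> y < \<tau>}"
            using fin by (intro card_mono) auto
          moreover have "card (w ` (?S0 - S)) = card (?S0 - S)"
            using w(1) by (intro card_image) (auto intro: inj_on_subset)
          moreover have "card {y \<in> v. t0 \<le> y \<and> y < \<tau>} \<le> card (S - ?S0)"
          proof -
            have "{y \<in> v. t0 \<le> y \<and> y < \<tau>} \<subseteq> w ` (S - ?S0)"
            proof
              fix y assume y: "y \<in> {y \<in> v. t0 \<le> y \<and> y < \<tau>}"
              then obtain r where r: "m \<le> r" "r < m + n" "w r = y" using w(4) by force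
              then have "r \<in> S" using ES y unfolding E_def by auto
              then show "y \<in> w ` (S - ?S0)" using r by auto
            qed
            then show ?thesis using finS by (meson card_image_le card_mono finite_Diff finite_imageI le_trans)
          qed
          ultimately show False using count S0 by linarith
        qed
        then obtain r1 where r1: "r1 < m" "r1 \<notin> S" "\<tau> \<le> w r1" by blast
        define t where "t = Max (w ` (?S0 - S))"
        have "t \<in> w ` (?S0 - S)" unfolding t_def using r1 by (intro Max_in) auto
        then obtain r where r: "r < m" "r \<notin> S" "w r = t" by auto
        have le: "w r' \<le> t" if "r' < m" "r' \<notin> S" for r' unfolding t_def using that by (intro Max_ge) auto
        have \<tau>t: "\<tau> \<le> t" using le[OF r1(1,2)] r1(3) by simp
        have tu: "t \<in> u" using wu r by blast
        \<comment> \<open>A copy of \<open>t\<close> in the lower row would lie in \<open>V\<close>,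
          hence stay there and collide with the copy coming down.\<close>
        have tv: "t \<notin> v"
        proof
          assume "t \<in> v"
          then obtain r2 where r2: "m \<le> r2" "r2 < m + n" "w r2 = t" using w(4) by force
          then have "r2 \<in> V" using \<tau>t unfolding V_def by auto
          then have "r2 \<in> ?U - S" using S(4) r2 by auto
          then show False using inj_onD[OF inj(2), of r r2] r r2 by auto
        qed
        have "t \<in> w ` (?U - S)" using r by auto
        then have tS: "t \<notin> w ` S" using content(2) tv by blast
        have above: "s \<in> w ` S \<longleftrightarrow> s \<in> u" if "t < s" for s
        proof
          assume "s \<in> w ` S"
          then obtain r' where r': "r' \<in> S" "w r' = s" by auto
          then have "r' \<notin> V" using S(4) by auto
          then have "r' < m" using r' S(1) \<tau>t that unfolding V_def by force
          then show "s \<in> u" using wu r' by auto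
        next
          assume "s \<in> u"
          then obtain r' where r': "r' < m" "w r' = s" using w(2) by force
          then have "r' \<in> S" using le[of r'] that by force
          then show "s \<in> w ` S" using r' by auto
        qed
        have "t \<in> exchange_key p u p' v"
          using tu True \<tau>t max unfolding exchange_key_def by force
        then show ?thesis using above tu tv tS by blast
      qed
    qed
    show ?thesis by (rule span_subst[OF main]) (use each in blast)
  next
    case False
    \<comment> \<open>The Garnir choice: upper letters from \<open>t0\<close> on against lower
      letters up to \<open>t0\<close>. Equality of the insertion columns gives \<open>E\<close>
      exactly one element more than there are columns for it.\<close>
    define F where "F = {r. r < m \<and> w r < t0}"
    define E where "E = {r. r < m \<and> t0 \<le> w r} \<union> {r. m \<le> r \<and> r < m + n \<and> w r \<le> t0}"
    define V where "V = {r. m \<le> r \<and> r < m + n \<and> t0 < w r}"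
    have main: "?sm ?S0 \<in> lpm.span {?sm S | S. S \<subseteq> ?U \<and> card S = m \<and> S \<noteq> ?S0 \<and> V \<inter> S = {} \<and> F \<subseteq> S}"
    proof (rule split_minor_exchange_skew)
      show "p' \<le> p" using False by simp
      show "p' + n \<le> p + m" using ends by (simp add: m_def n_def)
      show "p + m - p' < card E"
      proof -
        have "card {r. r < m \<and> t0 \<le> w r} = card {y \<in> u. t0 \<le> y}"
        proof -
          have "w ` {r. r < m \<and> t0 \<le> w r} = {y \<in> u. t0 \<le> y}" using w(2) by force
          moreover have "card (w ` {r. r < m \<and> t0 \<le> w r}) = card {r. r < m \<and> t0 \<le> w r}"
            by (rule card_image, rule inj_on_subset[OF w(1)]) auto
          ultimately show ?thesis by simp
        qed
        moreover have "card {r. m \<le> r \<and> r < m + n \<and> w r \<le> t0} = card {y \<in> v. y \<le> t0}"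
        proof -
          have "w ` {r. m \<le> r \<and> r < m + n \<and> w r \<le> t0} = {y \<in> v. y \<le> t0}" using w(4) by force
          moreover have "card (w ` {r. m \<le> r \<and> r < m + n \<and> w r \<le> t0}) = card {r. m \<le> r \<and> r < m + n \<and> w r \<le> t0}"
            by (rule card_image, rule inj_on_subset[OF w(3)]) auto
          ultimately show ?thesis by simp
        qed
        moreover have "card E = card {r. r < m \<and> t0 \<le> w r} + card {r. m \<le> r \<and> r < m + n \<and> w r \<le> t0}"
          unfolding E_def by (rule card_Un_disjoint) auto
        moreover have "card {y \<in> u. y < t0} + card {y \<in> u. t0 \<le> y} = m"
        proof -
          have "{y \<in> u. y < t0} \<union> {y \<in> u. t0 \<le> y} = u" by auto
          moreover have "card ({y \<in> u. y < t0} \<union> {y \<in> u. t0 \<le> y}) = card {y \<in> u. y < t0} + card {y \<in> u. t0 \<le> y}"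
            using fin by (intro card_Un_disjoint) auto
          ultimately show ?thesis by (simp add: m_def)
        qed
        moreover have "card {y \<in> v. y \<le> t0} = Suc (card {y \<in> v. y < t0})"
        proof -
          have "{y \<in> v. y \<le> t0} = insert t0 {y \<in> v. y < t0}" using t0(1) by auto
          then show ?thesis using fin by simp
        qed
        ultimately show ?thesis using t0(3) False unfolding insert_col_def by linarith
      qed
    qed (auto simp: F_def E_def V_def)
    have each: "?sm S \<in> ?better"
      if S: "S \<subseteq> ?U" "card S = m" "S \<noteq> ?S0" "V \<inter> S = {}" "F \<subseteq> S" for S
    proof (rule step[OF S(1,2)])
      assume inj: "inj_on w S" "inj_on w (?U - S)"
      have finS: "finite S" using S(1) by (rule finite_subset) simp
      note content = content[OF S(1) inj]
      have ne: "w ` (?S0 - S) \<noteq> {}"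
        using S(2,3) finS card_subset_eq[of S ?S0] by auto
      \<comment> \<open>Letters that rise are at most \<open>t0\<close>, and those that go down
        exceed it because \<open>t0\<close> is not in \<open>u\<close>. So the largest mover leaves
        the upper row.\<close>
      define t where "t = Max (w ` (?S0 - S))"
      have "t \<in> w ` (?S0 - S)" unfolding t_def using ne by (intro Max_in) auto
      then obtain r where r: "r < m" "r \<notin> S" "w r = t" by auto
      have le: "w r' \<le> t" if "r' < m" "r' \<notin> S" for r' unfolding t_def using that by (intro Max_ge) auto
      have tu: "t \<in> u" using wu r by blast
      have "r \<notin> F" using S(5) r by auto
      then have t0t: "t0 < t" using r tu t0(2) unfolding F_def by (auto simp: not_less order_le_less)
      have tv: "t \<notin> v"
      proof
        assume "t \<in> v"
        then obtain r2 where r2: "m \<le> r2" "r2 < m + n" "w r2 = t" using w(4) by force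
        then have "r2 \<in> V" using t0t unfolding V_def by auto
        then have "r2 \<in> ?U - S" using S(4) r2 by auto
        then show False using inj_onD[OF inj(2), of r r2] r r2 by auto
      qed
      have "t \<in> w ` (?U - S)" using r by auto
      then have tS: "t \<notin> w ` S" using content(2) tv by blast
      have above: "s \<in> w ` S \<longleftrightarrow> s \<in> u" if "t < s" for s
      proof
        assume "s \<in> w ` S"
        then obtain r' where r': "r' \<in> S" "w r' = s" by auto
        then have "r' \<notin> V" using S(4) by auto
        then have "r' < m" using r' S(1) t0t that unfolding V_def by force
        then show "s \<in> u" using wu r' by auto
      next
        assume "s \<in> u"
        then obtain r' where r': "r' < m" "w r' = s" using w(2) by force
        then have "r' \<in> S" using le[of r'] that by force
        then show "s \<in> w ` S" using r' by auto
      qed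
      have "t \<in> exchange_key p u p' v" using tu False unfolding exchange_key_def by simp
      then show "\<exists>t. (\<forall>s>t. s \<in> w ` S \<longleftrightarrow> s \<in> u) \<and>
        t \<in> exchange_key p u p' v \<and> (t \<in> u \<longleftrightarrow> t \<notin> w ` S) \<and> (t \<in> u \<longleftrightarrow> t \<notin> v)"
        using above tu tv tS by blast
    qed
    show ?thesis by (rule span_subst[OF main]) (use each in blast)
  qed
  moreover have "\<exists>e\<in>{1, -1}. ?sm ?S0 = e * (minor p (w ` ?S0) * minor p' (w ` (?U - ?S0)))"
    using w by (intro split_minor_cases(2)) (simp_all add: UD)
  then obtain e :: "('a, 'k) lpoly" where e: "e \<in> {1, -1}" "?sm ?S0 = e * pair_minor p p' (u, v)"
    unfolding UD w pair_minor_def prod.case by (elim bexE)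
  moreover have "pair_minor p p' (u, v) = e * ?sm ?S0"
    using e by (elim insertE) simp_all
  moreover have "e \<in> {0, 1, -1}" using e(1) by (rule insertI2)
  ultimately show ?thesis using span_scale_unit_or_zero[of e "?sm ?S0"] by metis
qed

definition straight_pairs :: "nat \<Rightarrow> 'a::linorder set \<Rightarrow> nat \<Rightarrow> 'a set \<Rightarrow> ('a set \<times> 'a set) set" where
  "straight_pairs p u p' v = {(u', v'). u' \<union> v' = u \<union> v \<and> u' \<inter> v' = u \<inter> v \<and> card u' = card u \<and> card v' = card v \<and>
     straight_pair p u' p' v'}"

lemma pair_straightening:
  fixes u v :: "'a::linorder set"
  assumes "finite u" "finite v" "p' + card v \<le> p + card u"
  shows "(pair_minor p p' (u, v) :: ('a, 'k::idom) lpoly) \<in> lpm.span (pair_minor p p' ` straight_pairs p u p' v)"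
  using assms
proof (induction "binary_weight (u \<union> v) (exchange_key p u p' v)" arbitrary: u v rule: less_induct)
  case less
  show ?case
  proof (cases "straight_pair p u p' v")
    case True
    then show ?thesis by (intro lpm.span_base imageI) (simp add: straight_pairs_def)
  next
    case False
    have "pair_minor p p' uv' \<in> lpm.span (pair_minor p p' ` straight_pairs p u p' v :: ('a, 'k) lpoly set)"
      if "uv' \<in> better_pairs p u p' v" for uv'
    proof -
      obtain u' v' where uv': "uv' = (u', v')" by fastforce
      have b: "u' \<union> v' = u \<union> v" "u' \<inter> v' = u \<inter> v" "card u' = card u" "card v' = card v"
        "binary_weight (u' \<union> v') (exchange_key p u' p' v') < binary_weight (u \<union> v) (exchange_key p u p' v)"
        using that unfolding uv' better_pairs_def by auto
      have "finite u'" "finite v'" using b(1) less.prems(1,2) by (metis finite_Un)+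
      moreover have "straight_pairs p u' p' v' = straight_pairs p u p' v"
        using b by (simp add: straight_pairs_def)
      ultimately show ?thesis using less.hyps[OF b(5)] less.prems(3) b uv' by simp
    qed
    then show ?thesis by (intro span_subst[OF pair_exchange[OF less.prems False]]) blast
  qed
qed

section \<open>Initial monomials\<close>

text \<open>A relational initial monomial. It fails for the zero polynomial, where
  \<open>initial_monom\<close> is an arbitrary value, and it keeps the support among the monomials
  on which \<open>prec\<close> is known to be an order.\<close>

definition leads ::
  "nat set \<Rightarrow> ('a lmonom \<Rightarrow> 'a lmonom \<Rightarrow> bool) \<Rightarrow> ('a, 'k::comm_ring_1) lpoly \<Rightarrow> 'a lmonom \<Rightarrow> bool" where
  "leads P prec f \<mu> \<longleftrightarrow> \<mu> \<in> Poly_Mapping.keys f \<and> Poly_Mapping.keys f \<subseteq> monoms_over P \<and>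
     (\<forall>m\<in>Poly_Mapping.keys f. m \<noteq> \<mu> \<longrightarrow> prec \<mu> m)"

lemma lookup_scale:
  "Poly_Mapping.lookup (Poly_Mapping.single 0 c * f) k = c * Poly_Mapping.lookup (f :: ('a, 'k::comm_ring_1) lpoly) k"
  unfolding mult_map_scale_conv_mult[symmetric] by (simp add: Poly_Mapping.map.rep_eq when_def)

lemma monoms_over_add: "m \<in> monoms_over P \<Longrightarrow> n \<in> monoms_over P \<Longrightarrow> m + n \<in> monoms_over P"
  unfolding monoms_over_def using keys_add[of m n] by auto

lemma monoms_over_zero: "0 \<in> monoms_over P"
  unfolding monoms_over_def by simp

lemma monoms_over_sum: "(\<And>i. i \<in> A \<Longrightarrow> m i \<in> monoms_over P) \<Longrightarrow> sum m A \<in> monoms_over P"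
  by (induction A rule: infinite_finite_induct) (auto simp: monoms_over_zero monoms_over_add)

lemma monom_var_over: "p \<in> P \<Longrightarrow> monom_var a p \<in> monoms_over P"
  unfolding monoms_over_def monom_var_def by simp

lemma poly_of_monom_add: "poly_of_monom (m + n) = (poly_of_monom m * poly_of_monom n :: ('a, 'k::comm_ring_1) lpoly)"
  by (simp add: poly_of_monom_def mult_single)

lemma poly_of_monom_zero: "poly_of_monom 0 = (1 :: ('a, 'k::comm_ring_1) lpoly)"
  by (simp add: poly_of_monom_def)

lemma poly_of_monom_sum: "poly_of_monom (sum m A) = (\<Prod>i\<in>A. poly_of_monom (m i) :: ('a, 'k::comm_ring_1) lpoly)"
  by (induction A rule: infinite_finite_induct) (simp_all add: poly_of_monom_zero poly_of_monom_add)

lemma lookup_of_int_monom: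
  "Poly_Mapping.lookup (of_int z * poly_of_monom m :: ('a, 'k::comm_ring_1) lpoly) k = (if k = m then of_int z else 0)"
proof -
  have "(of_int z :: ('a, 'k) lpoly) = Poly_Mapping.single 0 (of_int z)" by simp
  then show ?thesis by (simp only: lookup_scale) (simp add: poly_of_monom_def lookup_single when_def)
qed

lemma lookup_unit_mult:
  assumes "e \<in> {1, -1}"
  shows "\<exists>c\<in>{1, -1}. \<forall>k. Poly_Mapping.lookup (e * f) k = c * Poly_Mapping.lookup (f :: ('a, 'k::comm_ring_1) lpoly) k"
  using assms
proof (elim insertE)
  show "\<exists>c\<in>{1, -1}. \<forall>k. Poly_Mapping.lookup (e * f) k = c * Poly_Mapping.lookup f k" if "e = 1"
    using that by (intro bexI[of _ 1]) simp_all
  show "\<exists>c\<in>{1, -1}. \<forall>k. Poly_Mapping.lookup (e * f) k = c * Poly_Mapping.lookup f k" if "e = - 1"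
    using that by (intro bexI[of _ "- 1"]) simp_all
qed simp

text \<open>The diagonal monomial comes from the identity permutation alone, so it cannot cancel in
  any characteristic. Non-vanishing makes the diagonal clause of the term order a statement about a
  genuine smallest monomial.\<close>

lemma keys_biproduct:
  assumes "length ws = length ps" "set ps \<subseteq> P"
  shows "Poly_Mapping.keys (biproduct ws ps :: ('a, 'k::comm_ring_1) lpoly) \<subseteq> monoms_over P" (is ?over)
    and "distinct ws \<Longrightarrow> distinct ps \<Longrightarrow> (biproduct ws ps :: ('a, 'k) lpoly) \<noteq> 0"
proof -
  let ?n = "length ws"
  let ?M = "mat ?n ?n (\<lambda>(r, s). lpvar (ws ! r) (ps ! s)) :: ('a, 'k) lpoly mat"
  let ?PU = "{\<pi>. \<pi> permutes {0..<?n}}"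
  define c where "c \<pi> = (\<Sum>r\<in>{0..<?n}. monom_var (ws ! r) (ps ! \<pi> r))" for \<pi>
  have lt: "\<pi> r < ?n" if "\<pi> permutes {0..<?n}" "r < ?n" for \<pi> r
    using that permutes_in_image[of \<pi> "{0..<?n}" r] by auto
  have "det ?M = (\<Sum>\<pi>\<in>?PU. signof \<pi> * (\<Prod>r = 0..<?n. ?M $$ (r, \<pi> r)))"
    by (rule det_def') simp
  also have "\<dots> = (\<Sum>\<pi>\<in>?PU. signof \<pi> * poly_of_monom (c \<pi>))"
    unfolding c_def poly_of_monom_sum
    by (intro sum.cong refl arg_cong2[of _ _ _ _ "(*)"] prod.cong) (use lt in auto)
  finally have "Poly_Mapping.lookup (det ?M) k = (\<Sum>\<pi>\<in>?PU. if k = c \<pi> then signof \<pi> else 0)" for k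
    by (simp only: lookup_sum lookup_of_int_monom)
  moreover obtain d :: 'k where d: "d \<in> {1, -1}"
    "\<And>k. Poly_Mapping.lookup (biproduct ws ps) k = d * Poly_Mapping.lookup (det ?M) k"
    using lookup_unit_mult[OF minus_one_power_cases[of "?n choose 2"], of "det ?M"]
    unfolding biproduct_def Let_def by blast
  ultimately have lookup: "Poly_Mapping.lookup (biproduct ws ps) k = d * (\<Sum>\<pi>\<in>?PU. if k = c \<pi> then signof \<pi> else 0)" for k
    by simp
  show ?over
  proof
    fix k assume k: "k \<in> Poly_Mapping.keys (biproduct ws ps :: ('a, 'k) lpoly)"
    have "\<exists>\<pi>\<in>?PU. k = c \<pi>"
    proof (rule ccontr)
      assume "\<not> (\<exists>\<pi>\<in>?PU. k = c \<pi>)"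
      then have "(\<Sum>\<pi>\<in>?PU. if k = c \<pi> then (signof \<pi> :: 'k) else 0) = 0" by (intro sum.neutral) auto
      then show False using k lookup[of k] by (simp add: in_keys_iff)
    qed
    then obtain \<pi> where \<pi>: "\<pi> permutes {0..<?n}" "k = c \<pi>" by auto
    show "k \<in> monoms_over P"
      unfolding \<pi>(2) c_def
      using lt[OF \<pi>(1)] assms by (intro monoms_over_sum monom_var_over) (auto simp: subset_iff)
  qed
  show "biproduct ws ps \<noteq> (0 :: ('a, 'k) lpoly)" if dist: "distinct ws" "distinct ps"
  proof -
    \<comment> \<open>The monomial of \<pi> must contain the variable with letter
      \<open>ws ! r\<close> and column \<open>ps ! r\<close>. Only row \<open>r\<close> carries that
      letter, so \<pi> fixes \<open>r\<close>.\<close>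
    have id: "\<pi> = id" if "\<pi> permutes {0..<?n}" "c id = c \<pi>" for \<pi>
    proof
      fix r
      show "\<pi> r = id r"
      proof (cases "r < ?n")
        case True
        have "Poly_Mapping.lookup (c id) (ws ! r, ps ! r) =
            (\<Sum>r'\<in>{0..<?n}. if ws ! r' = ws ! r \<and> ps ! r' = ps ! r then 1 else 0)"
          by (auto simp: c_def lookup_sum monom_var_def lookup_single when_def intro!: sum.cong)
        also have "\<dots> \<noteq> 0" using True by (auto simp: sum_eq_0_iff)
        finally have "Poly_Mapping.lookup (c \<pi>) (ws ! r, ps ! r) \<noteq> 0" using that(2) by simp
        then obtain r' where r': "r' < ?n" "ws ! r' = ws ! r" "ps ! \<pi> r' = ps ! r"
          by (auto simp: c_def lookup_sum monom_var_def lookup_single when_def split: if_splits)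
        then have "r' = r" using True dist(1) nth_eq_iff_index_eq by blast
        then show ?thesis
          using r' dist(2) lt[OF that(1), of r] True assms(1) nth_eq_iff_index_eq[of ps "\<pi> r" r] by auto
      next
        case False
        then show ?thesis using that(1) by (simp add: permutes_def)
      qed
    qed
    have "(\<Sum>\<pi>\<in>?PU. if c id = c \<pi> then (signof \<pi> :: 'k) else 0) =
        (\<Sum>\<pi>\<in>?PU. if \<pi> = id then 1 else 0)"
      using id by (intro sum.cong) auto
    also have "\<dots> = 1" by (simp add: finite_permutations permutes_id)
    finally have "Poly_Mapping.lookup (biproduct ws ps) (c id) = d" using lookup[of "c id"] by simp
    then show ?thesis using d(1) by auto
  qed
qed

section \<open>Arithmetic of initial monomials\<close>

locale diagonal_order =
  fixes P :: "nat set" and prec :: "'a::linorder lmonom \<Rightarrow> 'a lmonom \<Rightarrow> bool" and field_type :: "'k::field itself"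
  assumes order: "diagonal_term_order field_type P prec"
begin

abbreviation "M \<equiv> monoms_over P"

abbreviation lead :: "('a, 'k) lpoly \<Rightarrow> 'a lmonom \<Rightarrow> bool" where
  "lead \<equiv> leads P prec"

lemma irrefl: "m \<in> M \<Longrightarrow> \<not> prec m m"
  using order unfolding diagonal_term_order_def irreflp_on_def by blast

lemma trans: "m \<in> M \<Longrightarrow> m' \<in> M \<Longrightarrow> m'' \<in> M \<Longrightarrow> prec m m' \<Longrightarrow> prec m' m'' \<Longrightarrow> prec m m''"
  using order unfolding diagonal_term_order_def transp_on_def by blast

lemma total: "m \<in> M \<Longrightarrow> m' \<in> M \<Longrightarrow> m \<noteq> m' \<Longrightarrow> prec m m' \<or> prec m' m"
  using order unfolding diagonal_term_order_def totalp_on_def by blast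

lemma add_mono: "m \<in> M \<Longrightarrow> m' \<in> M \<Longrightarrow> n \<in> M \<Longrightarrow> n' \<in> M \<Longrightarrow> prec m m' \<Longrightarrow> prec n n' \<Longrightarrow> prec (m + n) (m' + n')"
  using order unfolding diagonal_term_order_def by blast

text \<open>Monotonicity is only assumed for two strict inequalities. If \<open>m \<prec> m'\<close> but \<open>m' + n \<prec> m + n\<close>,
  then adding them makes \<open>m + m' + n\<close> smaller than itself.\<close>

lemma add_right_mono:
  assumes "m \<in> M" "m' \<in> M" "n \<in> M" "prec m m'"
  shows "prec (m + n) (m' + n)"
proof (rule ccontr)
  assume not: "\<not> prec (m + n) (m' + n)"
  have "m \<noteq> m'" using assms irrefl by auto
  then have "m + n \<noteq> m' + n" by simp
  then have "prec (m' + n) (m + n)" using not total[of "m + n" "m' + n"] assms monoms_over_add by blast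
  then have "prec (m + (m' + n)) (m' + (m + n))"
    by (rule add_mono[OF assms(1,2) monoms_over_add[OF assms(2,3)] monoms_over_add[OF assms(1,3)] assms(4)])
  moreover have "m + (m' + n) = m' + (m + n)" by (simp add: ac_simps)
  moreover have "m + (m' + n) \<in> M" using assms monoms_over_add by blast
  ultimately show False using irrefl by auto
qed

lemma lead_over: "lead f \<mu> \<Longrightarrow> \<mu> \<in> M"
  unfolding leads_def by blast

lemma lead_initial:
  assumes "lead f \<mu>"
  shows "initial_monom prec f = \<mu>"
  unfolding initial_monom_def
proof (rule the_equality)
  show "\<mu> \<in> Poly_Mapping.keys f \<and> (\<forall>m'\<in>Poly_Mapping.keys f. m' \<noteq> \<mu> \<longrightarrow> prec \<mu> m')"
    using assms unfolding leads_def by blast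
  fix m assume m: "m \<in> Poly_Mapping.keys f \<and> (\<forall>m'\<in>Poly_Mapping.keys f. m' \<noteq> m \<longrightarrow> prec m m')"
  have keys: "\<mu> \<in> Poly_Mapping.keys f" "Poly_Mapping.keys f \<subseteq> M" "\<And>m'. m' \<in> Poly_Mapping.keys f \<Longrightarrow> m' \<noteq> \<mu> \<Longrightarrow> prec \<mu> m'"
    using assms unfolding leads_def by auto
  show "m = \<mu>"
  proof (rule ccontr)
    assume "m \<noteq> \<mu>"
    then have "prec \<mu> m" "prec m \<mu>" "\<mu> \<in> M" "m \<in> M" using keys m by auto
    then show False using trans[of \<mu> m \<mu>] irrefl by blast
  qed
qed

lemma lead_unique: "lead f \<mu> \<Longrightarrow> lead f \<nu> \<Longrightarrow> \<mu> = \<nu>"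
  using lead_initial by metis

lemma min_monom:
  assumes "finite A" "A \<noteq> {}" "A \<subseteq> M"
  obtains \<mu> where "\<mu> \<in> A" "\<And>m. m \<in> A \<Longrightarrow> m \<noteq> \<mu> \<Longrightarrow> prec \<mu> m"
proof -
  have "\<exists>\<mu>\<in>A. \<forall>m\<in>A. m \<noteq> \<mu> \<longrightarrow> prec \<mu> m"
    using assms
  proof (induction rule: finite_ne_induct)
    case (insert x A)
    then obtain \<mu> where \<mu>: "\<mu> \<in> A" "\<And>m. m \<in> A \<Longrightarrow> m \<noteq> \<mu> \<Longrightarrow> prec \<mu> m" by auto
    have "\<mu> \<noteq> x" using insert \<mu> by auto
    then consider "prec \<mu> x" | "prec x \<mu>" using total insert.prems \<mu>(1) by blast
    then show ?case
    proof cases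
      case 1
      then show ?thesis using \<mu> by (intro bexI[of _ \<mu>]) auto
    next
      case 2
      have "prec x m" if "m \<in> A" for m
        using trans[of x \<mu> m] \<mu> 2 that insert.prems by (cases "m = \<mu>") auto
      then show ?thesis by (intro bexI[of _ x]) auto
    qed
  qed auto
  then show thesis using that by blast
qed

lemma lead_exists:
  assumes "f \<noteq> 0" "Poly_Mapping.keys f \<subseteq> M"
  shows "lead f (initial_monom prec f)"
proof -
  have "finite (Poly_Mapping.keys f)" "Poly_Mapping.keys f \<noteq> {}" using assms(1) by auto
  from min_monom[OF this assms(2)] obtain \<mu> where "lead f \<mu>"
    using assms(2) unfolding leads_def by metis
  then show ?thesis using lead_initial by simp
qed

text \<open>Every product of monomials other than that of the two smallest is strictly larger, and
  the product of two nonzero coefficients in a field is nonzero.\<close>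

lemma lead_mult:
  assumes "lead f \<mu>" "lead g \<nu>"
  shows "lead (f * g) (\<mu> + \<nu>)"
proof -
  define c d where "c = Poly_Mapping.lookup f \<mu>" and "d = Poly_Mapping.lookup g \<nu>"
  define f' g' where "f' = f - Poly_Mapping.single \<mu> c" and "g' = g - Poly_Mapping.single \<nu> d"
  have f: "\<mu> \<in> M" "c \<noteq> 0" "\<And>m. m \<in> Poly_Mapping.keys f \<Longrightarrow> m \<in> M" "\<And>m. m \<in> Poly_Mapping.keys f \<Longrightarrow> m \<noteq> \<mu> \<Longrightarrow> prec \<mu> m"
    using assms(1) unfolding leads_def c_def by (auto simp: in_keys_iff)
  have g: "\<nu> \<in> M" "d \<noteq> 0" "\<And>m. m \<in> Poly_Mapping.keys g \<Longrightarrow> m \<in> M" "\<And>m. m \<in> Poly_Mapping.keys g \<Longrightarrow> m \<noteq> \<nu> \<Longrightarrow> prec \<nu> m"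
    using assms(2) unfolding leads_def d_def by (auto simp: in_keys_iff)
  have f': "m \<in> M \<and> prec \<mu> m" if "m \<in> Poly_Mapping.keys f'" for m
  proof -
    have "m \<noteq> \<mu>" "m \<in> Poly_Mapping.keys f"
      using that unfolding f'_def c_def by (auto simp: in_keys_iff lookup_minus lookup_single when_def split: if_splits)
    then show ?thesis using f by blast
  qed
  have g': "m \<in> M \<and> prec \<nu> m" if "m \<in> Poly_Mapping.keys g'" for m
  proof -
    have "m \<noteq> \<nu>" "m \<in> Poly_Mapping.keys g"
      using that unfolding g'_def d_def by (auto simp: in_keys_iff lookup_minus lookup_single when_def split: if_splits)
    then show ?thesis using g by blast
  qed
  define h where "h = Poly_Mapping.single \<mu> c * g' + f' * g"
  have "f * g = (Poly_Mapping.single \<mu> c + f') * g" unfolding f'_def by simp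
  also have "\<dots> = Poly_Mapping.single \<mu> c * (Poly_Mapping.single \<nu> d + g') + f' * g"
    unfolding g'_def by (simp add: algebra_simps)
  also have "\<dots> = Poly_Mapping.single (\<mu> + \<nu>) (c * d) + h"
    unfolding h_def by (simp add: algebra_simps mult_single)
  finally have fg: "f * g = Poly_Mapping.single (\<mu> + \<nu>) (c * d) + h" .
  have h: "m \<in> M \<and> prec (\<mu> + \<nu>) m" if hm: "m \<in> Poly_Mapping.keys h" for m
  proof -
    consider "m \<in> Poly_Mapping.keys (Poly_Mapping.single \<mu> c * g')" | "m \<in> Poly_Mapping.keys (f' * g)"
      using hm keys_add[of "Poly_Mapping.single \<mu> c * g'" "f' * g"] unfolding h_def by blast
    then show ?thesis
    proof cases
      case 1
      then obtain b where b: "b \<in> Poly_Mapping.keys g'" "m = \<mu> + b"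
        using keys_mult[of "Poly_Mapping.single \<mu> c" g'] by (auto split: if_splits)
      then have "prec (\<nu> + \<mu>) (b + \<mu>)" using g' g f by (intro add_right_mono) auto
      then show ?thesis using b g' f by (auto simp: add.commute intro: monoms_over_add)
    next
      case 2
      then obtain a b where ab: "a \<in> Poly_Mapping.keys f'" "b \<in> Poly_Mapping.keys g" "m = a + b"
        using keys_mult[of f' g] by auto
      have "prec (\<mu> + \<nu>) (a + b)"
      proof (cases "b = \<nu>")
        case True
        then show ?thesis using ab f' f g by (auto intro: add_right_mono)
      next
        case False
        then show ?thesis using ab f' f g by (intro add_mono) auto
      qed
      then show ?thesis using ab f' g by (auto intro: monoms_over_add)
    qed
  qed
  have "\<mu> + \<nu> \<in> M" using f g monoms_over_add by blast
  then have "\<mu> + \<nu> \<notin> Poly_Mapping.keys h" using h irrefl by blast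
  then have "\<mu> + \<nu> \<in> Poly_Mapping.keys (f * g)"
    using f g unfolding fg by (simp add: in_keys_iff lookup_add)
  moreover have "m = \<mu> + \<nu> \<or> m \<in> Poly_Mapping.keys h" if "m \<in> Poly_Mapping.keys (f * g)" for m
    using that keys_add[of "Poly_Mapping.single (\<mu> + \<nu>) (c * d)" h] unfolding fg by (auto split: if_splits)
  ultimately show ?thesis using h \<open>\<mu> + \<nu> \<in> M\<close> unfolding leads_def by blast
qed

lemma lead_one: "lead 1 0"
  unfolding leads_def by (auto simp: monoms_over_zero)

lemma lead_prod:
  assumes "\<And>i. i \<in> A \<Longrightarrow> lead (f i) (\<mu> i)"
  shows "lead (prod f A) (sum \<mu> A)"
  using assms by (induction A rule: infinite_finite_induct) (auto intro: lead_one lead_mult)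

lemma lead_biproduct:
  assumes "length is = length js" "sorted_wrt (<) is" "sorted_wrt (<) js" "set js \<subseteq> P"
  shows "lead (biproduct is js) (\<Sum>l<length is. monom_var (is ! l) (js ! l))"
proof -
  have "distinct is" "distinct js" using assms(2,3) strict_sorted_iff by blast+
  then have "lead (biproduct is js) (initial_monom prec (biproduct is js :: ('a, 'k) lpoly))"
    using assms by (intro lead_exists keys_biproduct)
  also have "initial_monom prec (biproduct is js :: ('a, 'k) lpoly) = (\<Sum>l<length is. monom_var (is ! l) (js ! l))"
    using order assms unfolding diagonal_term_order_def by blast
  finally show ?thesis .
qed

text \<open>Elements with pairwise distinct initial monomials cannot cancel each other's smallest
  initial monomial in a linear combination.\<close>

lemma span_lead:
  assumes "f \<in> lpm.span A" "f \<noteq> 0"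
    and lead: "\<And>a. a \<in> A \<Longrightarrow> lead a (ld a)"
    and inj: "inj_on ld A"
  shows "\<exists>a\<in>A. lead f (ld a) \<and> f \<in> lpm.span {b \<in> A. ld b = ld a \<or> prec (ld a) (ld b)}"
proof -
  obtain t0 r where t0: "finite t0" "t0 \<subseteq> A" "f = (\<Sum>a\<in>t0. Poly_Mapping.single 0 (r a) * a)"
    using assms(1) unfolding lpm.span_explicit by auto
  define t where "t = {a \<in> t0. r a \<noteq> 0}"
  have t: "finite t" "t \<subseteq> A" "\<And>a. a \<in> t \<Longrightarrow> r a \<noteq> 0" unfolding t_def using t0 by auto
  have f: "f = (\<Sum>a\<in>t. Poly_Mapping.single 0 (r a) * a)"
    unfolding t0(3) t_def using t0(1) by (intro sum.mono_neutral_right) auto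
  have "t \<noteq> {}" using f assms(2) by auto
  then have "ld ` t \<noteq> {}" by simp
  moreover have "ld ` t \<subseteq> M" using lead lead_over t(2) by blast
  ultimately obtain \<mu> where \<mu>: "\<mu> \<in> ld ` t" "\<And>m. m \<in> ld ` t \<Longrightarrow> m \<noteq> \<mu> \<Longrightarrow> prec \<mu> m"
    using min_monom[of "ld ` t"] t(1) by blast
  then obtain a where a: "a \<in> t" "ld a = \<mu>" by auto
  have \<mu>M: "\<mu> \<in> M" using a t lead lead_over by blast
  have min: "ld b = \<mu> \<or> prec \<mu> (ld b)" if "b \<in> t" for b using \<mu>(2)[of "ld b"] that by auto
  \<comment> \<open>Among the terms in use only \<open>a\<close> contains \<mu>: the others have
    strictly larger initial monomials by injectivity and minimality.\<close>
  have keys: "m = \<mu> \<and> b = a \<or> prec \<mu> m" "m \<in> M" if b: "b \<in> t" and m: "m \<in> Poly_Mapping.keys b" for b m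
  proof -
    have l: "lead b (ld b)" using b t(2) lead by blast
    show mM: "m \<in> M" using l m unfolding leads_def by blast
    have m': "m = ld b \<or> prec (ld b) m" using l m unfolding leads_def by blast
    show "m = \<mu> \<and> b = a \<or> prec \<mu> m"
    proof (cases "b = a")
      case True
      then show ?thesis using m' a by auto
    next
      case False
      then have "ld b \<noteq> \<mu>" using inj_onD[OF inj, of b a] a b t(2) by auto
      then have "prec \<mu> (ld b)" using min[OF b] by simp
      then show ?thesis using m' trans[of \<mu> "ld b" m] \<mu>M mM lead_over[OF l] by auto
    qed
  qed
  have lookup: "Poly_Mapping.lookup f m = (\<Sum>b\<in>t. r b * Poly_Mapping.lookup b m)" for m
    unfolding f by (simp add: lookup_sum lookup_scale)
  have "Poly_Mapping.lookup f \<mu> = (\<Sum>b\<in>t. if b = a then r b * Poly_Mapping.lookup b \<mu> else 0)"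
    unfolding lookup
  proof (rule sum.cong[OF refl])
    fix b assume "b \<in> t"
    then show "r b * Poly_Mapping.lookup b \<mu> = (if b = a then r b * Poly_Mapping.lookup b \<mu> else 0)"
      using keys(1)[of b \<mu>] irrefl[OF \<mu>M] by (auto simp: in_keys_iff)
  qed
  also have "\<dots> = r a * Poly_Mapping.lookup a \<mu>" using t(1) a(1) by simp
  finally have "\<mu> \<in> Poly_Mapping.keys f"
    using t(3)[OF a(1)] lead[of a] a t(2) by (auto simp: in_keys_iff leads_def)
  moreover have "m \<in> M \<and> (m \<noteq> \<mu> \<longrightarrow> prec \<mu> m)" if "m \<in> Poly_Mapping.keys f" for m
  proof -
    have "\<exists>b\<in>t. m \<in> Poly_Mapping.keys b"
    proof (rule ccontr)
      assume "\<not> (\<exists>b\<in>t. m \<in> Poly_Mapping.keys b)"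
      then have "Poly_Mapping.lookup f m = 0" unfolding lookup by (intro sum.neutral) (auto simp: in_keys_iff)
      then show False using that by (simp add: in_keys_iff)
    qed
    then show ?thesis using keys by blast
  qed
  ultimately have "lead f (ld a)" using a unfolding leads_def by blast
  \<comment> \<open>\<mu> is minimal among all terms with nonzero coefficient, so no such term
    starts below \<open>f\<close>. The straightening of larger tableaux needs this control over
    every term.\<close>
  moreover have "f \<in> lpm.span {b \<in> A. ld b = ld a \<or> prec (ld a) (ld b)}"
    unfolding f using min t(2) a by (intro lpm.span_sum lpm.span_scale lpm.span_base) auto
  ultimately show ?thesis using a t(2) by blast
qed

end

section \<open>Straightening tableaux of row-convex shape\<close>

definition row_strict :: "shape \<Rightarrow> 'a::linorder tableau \<Rightarrow> bool" where
  "row_strict D T \<longleftrightarrow> (\<forall>i j k. (i, j) \<in> D \<and> (i, k) \<in> D \<and> j < k \<longrightarrow> T i j < T i k)"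

definition diag_monom :: "shape \<Rightarrow> 'a tableau \<Rightarrow> 'a lmonom" where
  "diag_monom D T = (\<Sum>(i, k)\<in>D. monom_var (T i k) k)"

definition letters :: "shape \<Rightarrow> 'a tableau \<Rightarrow> 'a set" where
  "letters D T = (\<lambda>(i, k). T i k) ` D"

lemma straight_row_strict: "straight D T \<Longrightarrow> row_strict D T"
  unfolding straight_def row_strict_def by blast

lemma finite_row_columns: "finite D \<Longrightarrow> finite (row_columns D i)"
  by (rule finite_subset[of _ "snd ` D"]) (force simp: row_columns_def)+

lemma shape_Sigma: "D = Sigma (fst ` D) (row_columns D)"
proof (rule Set.set_eqI)
  fix c
  show "c \<in> D \<longleftrightarrow> c \<in> Sigma (fst ` D) (row_columns D)"
    by (cases c) (auto simp: row_columns_def intro: rev_image_eqI)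
qed

lemma row_interval:
  assumes "row_convex_shape D"
  obtains p q where "row_columns D i = {p..<q}" "p \<le> q"
proof (cases "row_columns D i = {}")
  case True
  then show thesis using that[of 0 0] by simp
next
  case False
  let ?R = "row_columns D i"
  have fin: "finite ?R" using assms finite_row_columns unfolding row_convex_shape_def by blast
  have in_R: "Min ?R \<in> ?R" "Max ?R \<in> ?R" using False fin by auto
  have "?R = {Min ?R..<Suc (Max ?R)}"
  proof
    show "?R \<subseteq> {Min ?R..<Suc (Max ?R)}" using fin by (auto simp: less_Suc_eq_le)
    show "{Min ?R..<Suc (Max ?R)} \<subseteq> ?R"
    proof
      fix j assume "j \<in> {Min ?R..<Suc (Max ?R)}"
      then have "j = Min ?R \<or> j = Max ?R \<or> Min ?R < j \<and> j < Max ?R" by auto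
      then show "j \<in> ?R"
        using in_R assms unfolding row_convex_shape_def row_convex_def row_columns_def by blast
    qed
  qed
  moreover have "Min ?R \<le> Suc (Max ?R)" using fin in_R by (simp add: le_SucI)
  ultimately show thesis using that by blast
qed

lemma bracket_cong:
  assumes "finite D" "\<And>i k. (i, k) \<in> D \<Longrightarrow> T i k = S i k"
  shows "bracket D T = bracket D S"
  unfolding bracket_def row_biproduct_def Let_def
proof (intro prod.cong refl arg_cong2[of _ _ _ _ biproduct] map_cong)
  fix i k assume "k \<in> set (sorted_list_of_set (row_columns D i))"
  then have "(i, k) \<in> D" using assms(1) by (simp add: finite_row_columns) (simp add: row_columns_def)
  then show "T i k = S i k" by (rule assms(2))
qed

lemma lookup_diag_monom:
  assumes "finite D"
  shows "Poly_Mapping.lookup (diag_monom D T) (a, k) = card {i. (i, k) \<in> D \<and> T i k = a}"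
proof -
  have "Poly_Mapping.lookup (diag_monom D T) (a, k) = (\<Sum>c\<in>D. if T (fst c) (snd c) = a \<and> snd c = k then 1 else 0)"
    unfolding diag_monom_def lookup_sum
    by (intro sum.cong) (auto simp: monom_var_def lookup_single when_def)
  also have "\<dots> = card {c \<in> D. T (fst c) (snd c) = a \<and> snd c = k}"
    using sum.inter_filter[OF assms, of "\<lambda>_. 1 :: nat" "\<lambda>c. T (fst c) (snd c) = a \<and> snd c = k"] by simp
  also have "{c \<in> D. T (fst c) (snd c) = a \<and> snd c = k} = (\<lambda>i. (i, k)) ` {i. (i, k) \<in> D \<and> T i k = a}"
    by (auto simp: image_iff)
  also have "card \<dots> = card {i. (i, k) \<in> D \<and> T i k = a}"
    by (intro card_image inj_onI) simp
  finally show ?thesis .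
qed

text \<open>A straight filling is read off from its column contents: going through the columns from left
  to right and from top to bottom, the entry of a cell is the smallest available letter exceeding
  its left neighbour.\<close>

lemma not_straight_if_first_difference_greater:
  assumes "finite D" "row_strict D S" and diag: "diag_monom D T = diag_monom D S"
    and c: "(i, k) \<in> D" and less: "S i k < T i k"
    and before: "\<And>i' k'. (i', k') \<in> D \<Longrightarrow> (k', i') < (k, i) \<Longrightarrow> T i' k' = S i' k'"
  shows "\<not> straight D T"
proof
  \<comment> \<open>Straightness is supposed of \<open>T\<close>, but only strict rows of
    \<open>S\<close>. So where a straight filling first differs from a row-strict one of the same
    column contents, the straight one is smaller; termination of the straightening uses this
    too.\<close>
  assume T: "straight D T"
  define s where "s = S i k"
  let ?T = "{r. (r, k) \<in> D \<and> T r k = s}" and ?S = "{r. (r, k) \<in> D \<and> S r k = s}"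
  have "?T \<subseteq> fst ` D" "?S \<subseteq> fst ` D" by (auto intro: rev_image_eqI)
  then have fin: "finite ?T" "finite ?S" using assms(1) finite_subset by blast+
  have "card ?T = card ?S"
    using diag lookup_diag_monom[OF assms(1)] by metis
  moreover have "i \<in> ?S" "i \<notin> ?T" using c less unfolding s_def by auto
  \<comment> \<open>Row \<open>i\<close> holds \<open>s\<close> in \<open>S\<close> but not in
    \<open>T\<close>, so \<open>T\<close> must hold \<open>s\<close> in some row where
    \<open>S\<close> does not. Agreement of the earlier cells puts that row below
    \<open>i\<close>.\<close>
  ultimately have "\<not> ?T \<subseteq> ?S" using fin card_subset_eq[of ?S ?T] by auto
  then obtain r where r: "(r, k) \<in> D" "T r k = s" "S r k \<noteq> s" by auto
  then have "\<not> r < i" using before[of r k] by auto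
  moreover have "r \<noteq> i" using r less unfolding s_def by auto
  ultimately have "i < r" by simp
  moreover have "T i k > T r k" using r less unfolding s_def by simp
  \<comment> \<open>This inversion forces the left neighbour of the cell to be at least
    \<open>s\<close>. But that neighbour is shared with \<open>S\<close>, where it is smaller than
    \<open>s\<close>.\<close>
  ultimately have k: "0 < k" "(i, k - 1) \<in> D" "T r k \<le> T i (k - 1)"
    using T c r(1) unfolding straight_def by blast+
  have "T i (k - 1) = S i (k - 1)" using k(1,2) by (intro before) auto
  also have "\<dots> < S i k" using assms(2) k(1,2) c unfolding row_strict_def by simp
  finally show False using k(3) r(2) unfolding s_def by simp
qed

lemma first_difference:
  fixes D :: shape
  assumes "finite D" "(i0, k0) \<in> D" "T i0 k0 \<noteq> S i0 k0"
  obtains i k where "(i, k) \<in> D" "T i k \<noteq> S i k"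
    "\<And>i' k'. (i', k') \<in> D \<Longrightarrow> (k', i') < (k, i) \<Longrightarrow> T i' k' = S i' k'"
proof -
  \<comment> \<open>Cells are written column first, so that the lexicographic order on pairs reads
    the columns from left to right and each from top to bottom.\<close>
  let ?X = "{(k, i). (i, k) \<in> D \<and> T i k \<noteq> S i k}"
  have fin: "finite ?X" by (rule finite_subset[of _ "prod.swap ` D"]) (use assms(1) in force)+
  have ne: "?X \<noteq> {}" using assms(2,3) by auto
  obtain k i where m: "Min ?X = (k, i)" by (cases "Min ?X")
  have "(k, i) \<in> ?X" using Min_in[OF fin ne] m by simp
  moreover have "T i' k' = S i' k'" if "(i', k') \<in> D" "(k', i') < (k, i)" for i' k'
  proof (rule ccontr)
    assume "T i' k' \<noteq> S i' k'"
    then have "(k, i) \<le> (k', i')" using Min_le[OF fin, of "(k', i')"] that m by auto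
    then show False using that(2) by (meson leD)
  qed
  ultimately show thesis using that[of i k] by blast
qed

lemma straight_unique:
  assumes "finite D" "straight D T" "straight D S" "diag_monom D T = diag_monom D S" "(i, k) \<in> D"
  shows "T i k = S i k"
proof (rule ccontr)
  assume "T i k \<noteq> S i k"
  from first_difference[OF assms(1,5), of T S, OF this] obtain i k where c: "(i, k) \<in> D" "T i k \<noteq> S i k"
    "\<And>i' k'. (i', k') \<in> D \<Longrightarrow> (k', i') < (k, i) \<Longrightarrow> T i' k' = S i' k'" by metis
  then consider "S i k < T i k" | "T i k < S i k" by (meson neqE)
  then show False
  proof cases
    case 1
    then show False
      using not_straight_if_first_difference_greater[OF assms(1) _ assms(4) c(1) _ c(3)] assms(2,3)
        straight_row_strict by blast
  next
    case 2
    then show False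
      using not_straight_if_first_difference_greater[OF assms(1) _ assms(4)[symmetric] c(1) _ c(3)[symmetric]]
        assms(2,3) straight_row_strict by blast
  qed
qed

section \<open>Sorted rows and their minors\<close>

definition fill_row :: "nat \<Rightarrow> 'a::linorder set \<Rightarrow> nat \<Rightarrow> 'a" where
  "fill_row p u k = sorted_list_of_set u ! (k - p)"

lemma fill_row:
  assumes "finite u" "card u = q - p" "p \<le> q"
  shows "map (fill_row p u) [p..<q] = sorted_list_of_set u"
    and "fill_row p u ` {p..<q} = u"
    and "p \<le> j \<Longrightarrow> j < k \<Longrightarrow> k < q \<Longrightarrow> fill_row p u j < fill_row p u k"
proof -
  show m: "map (fill_row p u) [p..<q] = sorted_list_of_set u"
    using assms by (intro nth_equalityI) (auto simp: fill_row_def)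
  have "set (map (fill_row p u) [p..<q]) = u" unfolding m using assms(1) by simp
  then show "fill_row p u ` {p..<q} = u" by simp
  show "fill_row p u j < fill_row p u k" if "p \<le> j" "j < k" "k < q"
    unfolding fill_row_def
    using that assms strict_sorted_list_of_set[of u] by (intro sorted_wrt_nth_less[of "(<)"]) auto
qed

lemma strict_row_set:
  fixes f :: "nat \<Rightarrow> 'a::linorder"
  assumes strict: "\<And>j k. p \<le> j \<Longrightarrow> j < k \<Longrightarrow> k < q \<Longrightarrow> f j < f k"
  shows "inj_on f {p..<q}" "card (f ` {p..<q}) = q - p" "sorted_list_of_set (f ` {p..<q}) = map f [p..<q]"
proof -
  show inj: "inj_on f {p..<q}"
  proof (rule inj_onI)
    fix j k assume "j \<in> {p..<q}" "k \<in> {p..<q}" "f j = f k"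
    then show "j = k" using strict[of j k] strict[of k j] by (cases j k rule: linorder_cases) auto
  qed
  show "card (f ` {p..<q}) = q - p" using card_image[OF inj] by simp
  have "sorted_wrt (<) (map f [p..<q])"
    unfolding sorted_wrt_map by (rule sorted_wrt_mono_rel[OF _ sorted_wrt_upt]) (auto intro: strict)
  then show "sorted_list_of_set (f ` {p..<q}) = map f [p..<q]"
    using sorted_list_of_set.idem_if_sorted_distinct[of "map f [p..<q]"] by (simp add: strict_sorted_iff)
qed

lemma row_biproduct_minor:
  assumes "row_columns D i = {p..<q}" "p \<le> q"
    and "\<And>j k. p \<le> j \<Longrightarrow> j < k \<Longrightarrow> k < q \<Longrightarrow> T i j < T i k"
  shows "row_biproduct D T i = minor p (T i ` {p..<q})"
proof -
  have "card (T i ` {p..<q}) = q - p" "sorted_list_of_set (T i ` {p..<q}) = map (T i) [p..<q]"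
    using assms(3) by (intro strict_row_set; blast)+
  then show ?thesis
    unfolding row_biproduct_def minor_def assms(1) Let_def sorted_list_of_set_range
    by (simp only: le_add_diff_inverse[OF assms(2)])
qed

lemma insert_col_strict_row:
  assumes strict: "\<And>j k. p \<le> j \<Longrightarrow> j < k \<Longrightarrow> k < q \<Longrightarrow> f j < f k"
    and k: "p \<le> k" "k \<le> q" and below: "\<And>j. p \<le> j \<Longrightarrow> j < k \<Longrightarrow> f j < t"
    and above: "\<And>j. k \<le> j \<Longrightarrow> j < q \<Longrightarrow> t \<le> f j"
  shows "insert_col p (f ` {p..<q}) t = k"
proof -
  have "{y \<in> f ` {p..<q}. y < t} = f ` {p..<k}"
  proof (intro subset_antisym subsetI)
    fix y assume "y \<in> {y \<in> f ` {p..<q}. y < t}"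
    then obtain j where j: "p \<le> j" "j < q" "y = f j" "f j < t" by auto
    then have "j < k" using above[of j] by (meson leD not_le)
    then show "y \<in> f ` {p..<k}" using j by auto
  qed (use k below in auto)
  moreover have "card (f ` {p..<k}) = k - p"
    using strict_row_set(2)[of p k f] strict k by simp
  ultimately show ?thesis using k unfolding insert_col_def by simp
qed

lemma prod_unit_multiples:
  fixes f g :: "'b \<Rightarrow> 'r::comm_ring_1"
  assumes "finite A" "\<And>i. i \<in> A \<Longrightarrow> \<exists>e\<in>{1, -1}. f i = e * g i"
  shows "\<exists>e\<in>{1, -1}. prod f A = e * prod g A"
  using assms
proof (induction A rule: finite_induct)
  case (insert x A)
  then obtain e e' where e: "e \<in> {1, -1}" "f x = e * g x" "e' \<in> {1, -1}" "prod f A = e' * prod g A"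
    by (metis insertCI)
  then have "prod f (insert x A) = (e * e') * prod g (insert x A)"
    using insert.hyps by (simp add: mult_ac)
  then show ?case using mult_unit_cases[OF e(1,3)] by (rule bexI)
qed simp

text \<open>Sorting a row changes its biproduct by a sign at most, and a letter repeated in a row
  would make the bracket vanish.\<close>

lemma bracket_eq_row_strict:
  assumes D: "row_convex_shape D" and ne: "bracket D T \<noteq> (0 :: ('a::linorder, 'k::comm_ring_1) lpoly)"
  shows "\<exists>S. row_strict D S \<and> (\<exists>e\<in>{1, -1}. bracket D T = e * (bracket D S :: ('a, 'k) lpoly))"
proof -
  define S where "S i = fill_row (Min (row_columns D i)) (T i ` row_columns D i)" for i
  have finD: "finite D" using D unfolding row_convex_shape_def by blast
  have row: "(\<exists>e\<in>{1, -1}. row_biproduct D T i = e * (row_biproduct D S i :: ('a, 'k) lpoly)) \<and>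
      (\<forall>j k. (i, j) \<in> D \<and> (i, k) \<in> D \<and> j < k \<longrightarrow> S i j < S i k)" if i: "i \<in> fst ` D" for i
  proof -
    obtain p q where pq: "row_columns D i = {p..<q}" "p \<le> q" using row_interval[OF D] by blast
    have ne': "row_columns D i \<noteq> {}" using i by (auto simp: row_columns_def)
    then have "p < q" using pq by auto
    then have "Min {p..<q} = p" by (intro Min_eqI) auto
    then have S: "S i = fill_row p (T i ` {p..<q})" unfolding S_def pq by simp
    have Tr: "row_biproduct D T i = (biproduct (map (T i) [p..<q]) [p..<q] :: ('a, 'k) lpoly)"
      unfolding row_biproduct_def pq by (simp add: Let_def)
    have "row_biproduct D T i \<noteq> (0 :: ('a, 'k) lpoly)"
      using ne i finD unfolding bracket_def by (metis finite_imageI prod_zero)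
    then have dist: "distinct (map (T i) [p..<q])"
      using biproduct_not_distinct[of "map (T i) [p..<q]" "[p..<q]"] unfolding Tr by blast
    then have card: "card (T i ` {p..<q}) = q - p" using distinct_card by fastforce
    note fill = fill_row[OF _ card pq(2)]
    have Sr: "row_biproduct D S i = (minor p (T i ` {p..<q}) :: ('a, 'k) lpoly)"
      using row_biproduct_minor[OF pq, of S] fill unfolding S by simp
    have "\<exists>e\<in>{1, -1}. row_biproduct D T i = e * (row_biproduct D S i :: ('a, 'k) lpoly)"
      using biproduct_distinct[OF dist, of p, where ?'k = 'k] pq(2) unfolding Tr Sr by simp
    moreover have "S i j < S i k" if "(i, j) \<in> D" "(i, k) \<in> D" "j < k" for j k
    proof -
      have "j \<in> {p..<q}" "k \<in> {p..<q}" using that unfolding pq(1)[symmetric] row_columns_def by auto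
      then show ?thesis unfolding S using that(3) fill(3) by auto
    qed
    ultimately show ?thesis by blast
  qed
  have "row_strict D S" unfolding row_strict_def using row by (metis fst_conv image_eqI)
  moreover have "\<exists>e\<in>{1, -1}. bracket D T = e * (bracket D S :: ('a, 'k) lpoly)"
    unfolding bracket_def using finD row by (intro prod_unit_multiples) auto
  ultimately show ?thesis by blast
qed

text \<open>The bound on the letters confines the later rewriting to finitely many diagonal
  monomials, even when the alphabet is infinite.\<close>

lemma straightening_two_rows:
  fixes T :: "'a::linorder tableau"
  assumes D: "row_convex_shape D" and ij: "i < j" "fst ` D = {i, j}" and T: "row_strict D T"
  shows "(bracket D T :: ('a, 'k::idom) lpoly) \<in>
    lpm.span {bracket D S | S. straight D S \<and> letters D S \<subseteq> letters D T}" (is "_ \<in> lpm.span ?A")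
proof -
  obtain p q where pq: "row_columns D i = {p..<q}" "p \<le> q" using row_interval[OF D] by blast
  obtain p' q' where pq': "row_columns D j = {p'..<q'}" "p' \<le> q'" using row_interval[OF D] by blast
  have mem: "(i, k) \<in> D \<longleftrightarrow> p \<le> k \<and> k < q" "(j, k) \<in> D \<longleftrightarrow> p' \<le> k \<and> k < q'" for k
    using pq(1) pq'(1) unfolding row_columns_def by (auto simp: set_eq_iff)
  have rows: "r = i \<or> r = j" if "(r, k) \<in> D" for r k using that ij(2) by (metis fst_conv image_eqI insertE singletonD)
  have ne: "row_columns D i \<noteq> {}" "row_columns D j \<noteq> {}" using ij(2) by (force simp: row_columns_def)+
  then have lt: "p < q" "p' < q'" using pq pq' by auto
  have "Max (row_columns D j) \<le> Max (row_columns D i)"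
    using D ij(1) ne unfolding row_convex_shape_def rows_sorted_def by blast
  moreover have "Max {p..<q} = q - 1" "Max {p'..<q'} = q' - 1" using lt by (auto intro!: Max_eqI)
  ultimately have qq: "q' \<le> q" using pq pq' lt by simp
  have br: "bracket D S = (pair_minor p p' (S i ` {p..<q}, S j ` {p'..<q'}) :: ('a, 'k) lpoly)"
    if "row_strict D S" for S
  proof -
    have "row_biproduct D S i = (minor p (S i ` {p..<q}) :: ('a, 'k) lpoly)"
      using that mem unfolding row_strict_def by (intro row_biproduct_minor[OF pq]) auto
    moreover have "row_biproduct D S j = (minor p' (S j ` {p'..<q'}) :: ('a, 'k) lpoly)"
      using that mem unfolding row_strict_def by (intro row_biproduct_minor[OF pq']) auto
    ultimately show ?thesis unfolding bracket_def ij(2) pair_minor_def using ij(1) by simp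
  qed
  have "D = {i} \<times> {p..<q} \<union> {j} \<times> {p'..<q'}" using mem rows by force
  then have entries: "letters D S = S i ` {p..<q} \<union> S j ` {p'..<q'}" for S :: "'a tableau"
    unfolding letters_def by (simp add: image_Un) (auto simp: image_def)
  define u v where "u = T i ` {p..<q}" and "v = T j ` {p'..<q'}"
  have cards: "card u = q - p" "card v = q' - p'"
    unfolding u_def v_def using T mem unfolding row_strict_def by (auto intro!: strict_row_set(2))
  have "pair_minor p p' (u, v) \<in> lpm.span (pair_minor p p' ` straight_pairs p u p' v :: ('a, 'k) lpoly set)"
    using cards qq pq(2) pq'(2) by (intro pair_straightening) (auto simp: u_def v_def)
  moreover have "pair_minor p p' ` straight_pairs p u p' v \<subseteq> (?A :: ('a, 'k) lpoly set)"
  proof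
    fix b :: "('a, 'k) lpoly" assume "b \<in> pair_minor p p' ` straight_pairs p u p' v"
    then obtain u' v' where b: "b = pair_minor p p' (u', v')" and uv: "u' \<union> v' = u \<union> v"
      "card u' = q - p" "card v' = q' - p'" "straight_pair p u' p' v'"
      unfolding straight_pairs_def cards by auto
    have "finite (u \<union> v)" unfolding u_def v_def by simp
    then have fin: "finite u'" "finite v'" using uv(1) by (metis finite_Un)+
    note fu = fill_row[OF fin(1) uv(2) pq(2)] and fv = fill_row[OF fin(2) uv(3) pq'(2)]
    define S where "S r = (if r = i then fill_row p u' else fill_row p' v')" for r
    have S: "S i = fill_row p u'" "S j = fill_row p' v'" using ij(1) by (auto simp: S_def)
    have strict: "row_strict D S"
      unfolding row_strict_def using rows mem fu(3) fv(3) S by (metis (no_types))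
    have "straight D S"
      unfolding straight_def
    proof (intro conjI allI impI)
      fix r a k assume "(r, a) \<in> D \<and> (r, k) \<in> D \<and> a < k"
      then show "S r a < S r k" using strict unfolding row_strict_def by blast
    next
      fix r s k assume a: "(r, k) \<in> D \<and> (s, k) \<in> D \<and> r < s \<and> S s k < S r k"
      then have rs: "r = i" "s = j" using rows ij(1) by (metis less_asym' nat_neq_iff)+
      define t where "t = S j k"
      have k: "p \<le> k" "k < q" "p' \<le> k" "k < q'" "t < S i k" using a rs mem unfolding t_def by auto
      have "0 < k \<and> (i, k - 1) \<in> D \<and> t \<le> S i (k - 1)"
      proof (rule ccontr)
        assume not: "\<not> (0 < k \<and> (i, k - 1) \<in> D \<and> t \<le> S i (k - 1))"
        \<comment> \<open>If \<open>k\<close> is the first column of the upper row there is no such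
          \<open>a\<close>. Otherwise the left neighbour exists, the failing condition puts it below
          \<open>t\<close>, and strictness carries this to all earlier entries.\<close>
        have below: "S i a < t" if "p \<le> a" "a < k" for a
        proof -
          have "0 < k" using that by linarith
          moreover have "(i, k - 1) \<in> D" unfolding mem using that k(2) by linarith
          ultimately have "S i (k - 1) < t" using not by (meson not_le)
          moreover have "S i a \<le> S i (k - 1)"
          proof (cases "a = k - 1")
            case False
            then have "a < k - 1" "k - 1 < q" using that k(2) by linarith+
            then show ?thesis unfolding S using fu(3)[OF that(1)] by (simp add: less_imp_le)
          qed simp
          ultimately show ?thesis by simp
        qed
        have above: "t < S i a" if "k \<le> a" "a < q" for a
          using fu(3)[of k a] that k unfolding S by (cases "a = k") auto
        have "insert_col p (fill_row p u' ` {p..<q}) t = k"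
          using k fu(3) below above unfolding S by (intro insert_col_strict_row) (auto intro: less_imp_le)
        then have "insert_col p u' t = k" unfolding fu(2) .
        moreover have "insert_col p' (fill_row p' v' ` {p'..<q'}) t = k"
        proof (rule insert_col_strict_row)
          show "t \<le> fill_row p' v' a" if "k \<le> a" "a < q'" for a
            using fv(3)[of k a] that k unfolding t_def S by (cases "a = k") auto
        qed (use k fv(3) in \<open>auto simp: t_def S\<close>)
        then have "insert_col p' v' t = k" unfolding fv(2) .
        moreover have "t \<in> v'" using fv(2) k unfolding t_def S by auto
        moreover have "t \<notin> u'"
        proof
          assume "t \<in> u'"
          then have "t \<in> fill_row p u' ` {p..<q}" unfolding fu(2) .
          then obtain a where "p \<le> a" "a < q" "t = S i a" unfolding S by auto
          then show False using below[of a] above[of a] by (cases "a < k") auto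
        qed
        ultimately show False using uv(4) unfolding straight_pair_def by auto
      qed
      then show "0 < k" "(r, k - 1) \<in> D" "S s k \<le> S r (k - 1)" unfolding t_def rs by auto
    qed
    moreover have "b = bracket D S" unfolding br[OF strict] b S fu(2) fv(2) ..
    moreover have "letters D S \<subseteq> letters D T"
      unfolding entries S fu(2) fv(2) uv(1) unfolding u_def v_def by simp
    ultimately show "b \<in> ?A" by blast
  qed
  ultimately show ?thesis
    unfolding br[OF T] u_def[symmetric] v_def[symmetric] using lpm.span_mono by blast
qed

section \<open>Separating some rows from the others\<close>

lemma row_convex_shape_restrict:
  assumes "row_convex_shape D"
  shows "row_convex_shape {c \<in> D. fst c \<in> I}" (is "row_convex_shape ?D'")
  unfolding row_convex_shape_def
proof (intro conjI)
  have D: "finite D" "row_convex D" "rows_sorted D" using assms unfolding row_convex_shape_def by auto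
  show "finite ?D'" using D(1) by simp
  show "row_convex ?D'"
    unfolding row_convex_def
  proof (intro allI impI)
    fix r a b c assume "(r, a) \<in> ?D' \<and> (r, c) \<in> ?D' \<and> a < b \<and> b < c"
    moreover from this have "(r, b) \<in> D" using D(2) unfolding row_convex_def by blast
    ultimately show "(r, b) \<in> ?D'" by simp
  qed
  have rows: "row_columns ?D' r = row_columns D r" if "row_columns ?D' r \<noteq> {}" for r
    using that unfolding row_columns_def by auto
  show "rows_sorted ?D'"
    unfolding rows_sorted_def
  proof (intro allI impI)
    fix r r' assume r: "r < r' \<and> row_columns ?D' r \<noteq> {} \<and> row_columns ?D' r' \<noteq> {}"
    then have eq: "row_columns ?D' r = row_columns D r" "row_columns ?D' r' = row_columns D r'"
      using rows by simp_all
    show "Max (row_columns ?D' r') \<le> Max (row_columns ?D' r)"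
      using D(3)[unfolded rows_sorted_def, rule_format, of r r'] r unfolding eq by blast
  qed
qed

lemma bracket_restrict:
  assumes "finite D" "D' = {c \<in> D. fst c \<in> I}"
  shows "bracket D T = bracket D' T * (bracket (D - D') T :: ('a, 'k::comm_ring_1) lpoly)"
proof -
  have rows: "row_columns D' i = row_columns D i" if "i \<in> I" for i
    using that assms(2) unfolding row_columns_def by auto
  have rows': "row_columns (D - D') i = row_columns D i" if "i \<notin> I" for i
    using that assms(2) unfolding row_columns_def by auto
  have fst: "fst ` D' = fst ` D \<inter> I" "fst ` (D - D') = fst ` D - I" using assms(2) by force+
  have "bracket D' T = (\<Prod>i\<in>fst ` D \<inter> I. row_biproduct D T i :: ('a, 'k) lpoly)"
    unfolding bracket_def fst by (intro prod.cong refl) (simp add: row_biproduct_def rows)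
  moreover have "bracket (D - D') T = (\<Prod>i\<in>fst ` D - I. row_biproduct D T i :: ('a, 'k) lpoly)"
    unfolding bracket_def fst by (intro prod.cong refl) (simp add: row_biproduct_def rows')
  moreover have "(\<Prod>i\<in>fst ` D. row_biproduct D T i :: ('a, 'k) lpoly) =
      (\<Prod>i\<in>fst ` D \<inter> I. row_biproduct D T i) * (\<Prod>i\<in>fst ` D - I. row_biproduct D T i)"
    using assms(1) by (intro prod.Int_Diff) simp
  ultimately show ?thesis by (simp only: bracket_def[of D])
qed

lemma diag_monom_restrict:
  assumes "finite D" "D' \<subseteq> D"
  shows "diag_monom D T = diag_monom D' T + diag_monom (D - D') T"
  using sum.subset_diff[OF assms(2,1), of "\<lambda>(i, k). monom_var (T i k) k"]
  unfolding diag_monom_def by (simp only: add.commute)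

lemma diag_monom_cong:
  assumes "\<And>i k. (i, k) \<in> D \<Longrightarrow> T i k = S i k"
  shows "diag_monom D T = diag_monom D S"
  unfolding diag_monom_def by (intro sum.cong refl) (auto simp: assms)

lemma span_mult_right:
  assumes "f \<in> lpm.span A"
  shows "f * g \<in> lpm.span ((\<lambda>a. a * g) ` A)"
  using assms
proof (induction rule: lpm.span_induct_alt)
  case base
  show ?case using lpm.span_zero by simp
next
  case (step c x y)
  have "(Poly_Mapping.single 0 c * x + y) * g = Poly_Mapping.single 0 c * (x * g) + y * g"
    by (simp add: algebra_simps)
  moreover have "Poly_Mapping.single 0 c * (x * g) + y * g \<in> lpm.span ((\<lambda>a. a * g) ` A)"
    by (rule lpm.span_add[OF lpm.span_scale[OF lpm.span_base[OF imageI[OF step(1)]]] step(2)])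
  ultimately show ?case by simp
qed

text \<open>Letters are replaced by their ranks in the finite set \<open>Z\<close>: the alphabet
  need not be well-founded, but \<open>lex less_than\<close> on words of natural numbers is.\<close>

definition column_word :: "'a::linorder set \<Rightarrow> shape \<Rightarrow> 'a tableau \<Rightarrow> nat list" where
  "column_word Z D T = map (\<lambda>(k, i). card {z \<in> Z. z < T i k}) (sorted_list_of_set (prod.swap ` D))"

lemma column_word_less:
  assumes "finite D" "finite Z" "S i k \<in> Z" "(i, k) \<in> D" "S i k < T i k"
    and before: "\<And>i' k'. (i', k') \<in> D \<Longrightarrow> (k', i') < (k, i) \<Longrightarrow> T i' k' = S i' k'"
  shows "(column_word Z D S, column_word Z D T) \<in> lex less_than"
proof -
  let ?cs = "sorted_list_of_set (prod.swap ` D)"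
  let ?f = "\<lambda>T (k, i). card {z \<in> Z. z < T i k}"
  have set: "set ?cs = prod.swap ` D" using assms(1) by simp
  then have "(k, i) \<in> set ?cs" using assms(4) by force
  then obtain a b where ab: "?cs = a @ (k, i) # b" by (meson split_list)
  have "sorted_wrt (<) ?cs" by simp
  then have "c < (k, i)" if "c \<in> set a" for c using that unfolding ab sorted_wrt_append by auto
  then have "map (?f S) a = map (?f T) a"
  proof (intro map_cong refl)
    fix c assume lt: "\<And>c. c \<in> set a \<Longrightarrow> c < (k, i)" and c: "c \<in> set a"
    obtain k' i' where c': "c = (k', i')" by (cases c)
    have "c \<in> prod.swap ` D" using set c unfolding ab by auto
    then have "(i', k') \<in> D" unfolding c' by auto
    then show "?f S c = ?f T c" using before[of i' k'] lt[OF c] unfolding c' by simp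
  qed
  moreover have "card {z \<in> Z. z < S i k} < card {z \<in> Z. z < T i k}"
    using assms(2,3,5) by (intro psubset_card_mono) auto
  ultimately show ?thesis
    unfolding column_word_def ab lex_conv by (auto intro!: exI[of _ "map (?f T) a"])
qed

section \<open>Straightening in a general row-convex shape\<close>

context diagonal_order
begin

lemma row_biproduct_lead:
  assumes "finite D" "snd ` D \<subseteq> P" "row_strict D T"
  shows "lead (row_biproduct D T i) (\<Sum>k\<in>row_columns D i. monom_var (T i k) k)"
proof -
  let ?ps = "sorted_list_of_set (row_columns D i)"
  have set: "set ?ps = row_columns D i" using finite_row_columns[OF assms(1)] by simp
  have "sorted_wrt (<) (map (T i) ?ps)"
    unfolding sorted_wrt_map
  proof (rule sorted_wrt_mono_rel[of _ "(<)"])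
    show "T i j < T i k" if "j \<in> set ?ps" "k \<in> set ?ps" "j < k" for j k
    proof -
      have "j \<in> row_columns D i" "k \<in> row_columns D i" using that(1,2) set by auto
      then show ?thesis using that(3) assms(3) unfolding row_columns_def row_strict_def by blast
    qed
  qed simp
  moreover have "set ?ps \<subseteq> P" unfolding set using assms(2) by (force simp: row_columns_def)
  ultimately have "lead (biproduct (map (T i) ?ps) ?ps)
      (\<Sum>l<length (map (T i) ?ps). monom_var (map (T i) ?ps ! l) (?ps ! l))"
    by (intro lead_biproduct) auto
  also have "(\<Sum>l<length (map (T i) ?ps). monom_var (map (T i) ?ps ! l) (?ps ! l)) =
      (\<Sum>l<length ?ps. (\<lambda>k. monom_var (T i k) k) (?ps ! l))"
    by (intro sum.cong) auto
  also have "\<dots> = (\<Sum>k\<in>row_columns D i. monom_var (T i k) k)"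
    using sum.distinct_set_conv_list[of ?ps "\<lambda>k. monom_var (T i k) k"]
    unfolding set by (simp add: sum_list_sum_nth atLeast0LessThan)
  finally show ?thesis unfolding row_biproduct_def Let_def .
qed

lemma bracket_lead:
  assumes "finite D" "snd ` D \<subseteq> P" "row_strict D T"
  shows "lead (bracket D T) (diag_monom D T)"
proof -
  have "diag_monom D T = (\<Sum>i\<in>fst ` D. \<Sum>k\<in>row_columns D i. monom_var (T i k) k)"
    unfolding diag_monom_def
    by (subst shape_Sigma) (use assms(1) in \<open>simp add: sum.Sigma finite_row_columns\<close>)
  then show ?thesis unfolding bracket_def using row_biproduct_lead[OF assms] by (auto intro: lead_prod)
qed

lemma straight_lead:
  assumes "finite D" "snd ` D \<subseteq> P" "straight D T"
  shows "lead (bracket D T) (diag_monom D T)"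
  using bracket_lead[OF assms(1,2) straight_row_strict[OF assms(3)]] .

lemma straight_initial_inj:
  assumes "finite D" "snd ` D \<subseteq> P"
  shows "inj_on (initial_monom prec) {bracket D S :: ('a, 'k) lpoly | S. straight D S}"
proof (rule inj_onI)
  fix f g assume "f \<in> {bracket D S :: ('a, 'k) lpoly | S. straight D S}" "g \<in> {bracket D S :: ('a, 'k) lpoly | S. straight D S}"
    and eq: "initial_monom prec f = initial_monom prec g"
  then obtain S S' where S: "f = bracket D S" "straight D S" "g = bracket D S'" "straight D S'" by auto
  have "initial_monom prec f = diag_monom D S" "initial_monom prec g = diag_monom D S'"
    unfolding S(1,3) by (rule lead_initial[OF straight_lead[OF assms S(2)]] lead_initial[OF straight_lead[OF assms S(4)]])+
  then have "diag_monom D S = diag_monom D S'" using eq by simp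
  then show "f = g" using straight_unique[OF assms(1) S(2,4)] unfolding S(1,3) by (intro bracket_cong assms(1))
qed

lemma straightening_row_strict:
  assumes D: "row_convex_shape D" "snd ` D \<subseteq> P" and "row_strict D T"
  shows "(bracket D T :: ('a, 'k) lpoly) \<in> lpm.span {bracket D S | S. straight D S}" (is "_ \<in> lpm.span ?A")
proof -
  have finD: "finite D" using D(1) unfolding row_convex_shape_def by blast
  define Z where "Z = letters D T"
  have finZ: "finite Z" unfolding Z_def letters_def using finD by simp
  \<comment> \<open>All diagonal monomials of fillings by \<open>Z\<close>. Rewriting makes the
    monomial grow; inside this finite set growth can be counted down, by the number of monomials
    still above.\<close>
  define Mon where "Mon = (\<lambda>g. \<Sum>c\<in>D. monom_var (g c) (snd c)) ` (D \<rightarrow>\<^sub>E Z)"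
  have finMon: "finite Mon" unfolding Mon_def using finD finZ by (simp add: finite_PiE)
  have diag_Mon: "diag_monom D S \<in> Mon" if "letters D S \<subseteq> Z" for S
  proof -
    have "diag_monom D S = (\<Sum>c\<in>D. monom_var (restrict (\<lambda>(i, k). S i k) D c) (snd c))"
      unfolding diag_monom_def by (intro sum.cong) auto
    moreover have "restrict (\<lambda>(i, k). S i k) D \<in> D \<rightarrow>\<^sub>E Z" using that unfolding letters_def by auto
    ultimately show ?thesis unfolding Mon_def by blast
  qed
  have Mon_over: "Mon \<subseteq> M"
    unfolding Mon_def using D(2) by (auto intro!: monoms_over_sum monom_var_over)
  define rank where "rank T = card {\<nu> \<in> Mon. prec (diag_monom D T) \<nu>}" for T
  have rank_less: "rank S < rank T"
    if "letters D T \<subseteq> Z" "letters D S \<subseteq> Z" "prec (diag_monom D T) (diag_monom D S)" for S T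
    unfolding rank_def
  proof (rule psubset_card_mono)
    have m: "diag_monom D T \<in> M" "diag_monom D S \<in> M" "diag_monom D S \<in> Mon"
      using that diag_Mon Mon_over by auto
    then have "{\<nu> \<in> Mon. prec (diag_monom D S) \<nu>} \<subseteq> {\<nu> \<in> Mon. prec (diag_monom D T) \<nu>}"
      using trans[OF m(1,2) _ that(3)] Mon_over by auto
    moreover have "diag_monom D S \<in> {\<nu> \<in> Mon. prec (diag_monom D T) \<nu>}"
      "diag_monom D S \<notin> {\<nu> \<in> Mon. prec (diag_monom D S) \<nu>}"
      using m that(3) irrefl by auto
    ultimately show "{\<nu> \<in> Mon. prec (diag_monom D S) \<nu>} \<subset> {\<nu> \<in> Mon. prec (diag_monom D T) \<nu>}" by blast
  qed (use finMon in simp)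
  let ?R = "inv_image (less_than <*lex*> lex less_than) (\<lambda>T. (rank T, column_word Z D T))"
  have wf: "wf ?R" by (intro wf_inv_image wf_lex_prod wf_less_than wf_lex)
  have "bracket D T \<in> lpm.span ?A" if "row_strict D T" "letters D T \<subseteq> Z" for T
    using wf that
  proof (induction T rule: wf_induct_rule)
    case (less T)
    show ?case
    proof (cases "straight D T")
      case True
      then show ?thesis by (intro lpm.span_base) blast
    next
      case False
      then obtain i j k where ij: "(i, k) \<in> D" "(j, k) \<in> D" "i < j" "T j k < T i k"
        "\<not> (0 < k \<and> (i, k - 1) \<in> D \<and> T j k \<le> T i (k - 1))"
        using less.prems(1) unfolding straight_def row_strict_def by blast
      define D' where "D' = {c \<in> D. fst c \<in> {i, j}}"
      have sub: "D' \<subseteq> D" unfolding D'_def by auto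
      have finD': "finite D'" using sub finD finite_subset by blast
      have shape: "row_convex_shape D'" unfolding D'_def by (rule row_convex_shape_restrict[OF D(1)])
      have P': "snd ` D' \<subseteq> P" using sub D(2) by blast
      have fst: "fst ` D' = {i, j}" unfolding D'_def using ij(1,2) by force
      have strict: "row_strict D' T" using less.prems(1) sub unfolding row_strict_def by blast
      have not: "\<not> straight D' T"
      proof
        assume s: "straight D' T"
        have "(i, k) \<in> D'" "(j, k) \<in> D'" using ij(1,2) unfolding D'_def by auto
        then have "0 < k \<and> (i, k - 1) \<in> D' \<and> T j k \<le> T i (k - 1)"
          using s ij(3,4) unfolding straight_def by blast
        then show False using ij(5) sub by blast
      qed
      let ?B = "{bracket D' S | S. straight D' S \<and> letters D' S \<subseteq> letters D' T} :: ('a, 'k) lpoly set"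
      have span: "bracket D' T \<in> lpm.span ?B" by (rule straightening_two_rows[OF shape ij(3) fst strict])
      have leadT: "lead (bracket D' T) (diag_monom D' T)" by (rule bracket_lead[OF finD' P' strict])
      then have "bracket D' T \<noteq> (0 :: ('a, 'k) lpoly)" unfolding leads_def by auto
      moreover have "lead b (initial_monom prec b)" if "b \<in> ?B" for b
      proof -
        from that obtain S where S: "b = bracket D' S" "straight D' S" by blast
        show ?thesis using straight_lead[OF finD' P' S(2)] lead_initial[OF straight_lead[OF finD' P' S(2)]]
          unfolding S(1) by simp
      qed
      moreover have "inj_on (initial_monom prec) ?B"
        by (rule inj_on_subset[OF straight_initial_inj[OF finD' P']]) blast
      \<comment> \<open>The straight two-row terms have distinct initial monomials, so the smallest
        among those used is the initial monomial of the pair being replaced. Hence all of them can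
        be chosen at or above it.\<close>
      ultimately have "\<exists>a\<in>?B. lead (bracket D' T) (initial_monom prec a) \<and>
        bracket D' T \<in> lpm.span {b \<in> ?B. initial_monom prec b = initial_monom prec a \<or>
          prec (initial_monom prec a) (initial_monom prec b)}"
        by (intro span_lead[OF span])
      then obtain a where a: "a \<in> ?B" "lead (bracket D' T) (initial_monom prec a)"
        "bracket D' T \<in> lpm.span {b \<in> ?B. initial_monom prec b = initial_monom prec a \<or>
          prec (initial_monom prec a) (initial_monom prec b)}"
        by (elim bexE conjE)
      have \<mu>: "initial_monom prec a = diag_monom D' T" using lead_unique[OF a(2) leadT] .
      let ?C = "{b \<in> ?B. initial_monom prec b = diag_monom D' T \<or> prec (diag_monom D' T) (initial_monom prec b)}"
      have "bracket D T = bracket D' T * (bracket (D - D') T :: ('a, 'k) lpoly)"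
        by (rule bracket_restrict[OF finD D'_def])
      then have in_span: "bracket D T \<in> lpm.span ((\<lambda>b. b * bracket (D - D') T) ` ?C)"
        using span_mult_right[OF a(3)] unfolding \<mu> by simp
      have each: "b * bracket (D - D') T \<in> lpm.span ?A" if b: "b \<in> ?C" for b
      proof -
        obtain S where S: "b = bracket D' S" "straight D' S" "letters D' S \<subseteq> letters D' T"
          using b by auto
        have "initial_monom prec b = diag_monom D' S"
          unfolding S(1) by (rule lead_initial[OF straight_lead[OF finD' P' S(2)]])
        then have cmp: "diag_monom D' S = diag_monom D' T \<or> prec (diag_monom D' T) (diag_monom D' S)"
          using b by auto
        define T' where "T' r = (if r \<in> {i, j} then S r else T r)" for r
        have T'1: "T' r c = S r c" if "(r, c) \<in> D'" for r c using that unfolding T'_def D'_def by auto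
        have T'2: "T' r c = T r c" if "(r, c) \<in> D - D'" for r c using that unfolding T'_def D'_def by auto
        have br: "b * bracket (D - D') T = bracket D T'"
        proof -
          have "bracket D' T' = (bracket D' S :: ('a, 'k) lpoly)" using T'1 by (intro bracket_cong finD')
          moreover have "bracket (D - D') T' = (bracket (D - D') T :: ('a, 'k) lpoly)" using T'2 finD by (intro bracket_cong) auto
          ultimately show ?thesis unfolding S(1) bracket_restrict[OF finD D'_def, of T'] by (simp only:)
        qed
        have diagT': "diag_monom D T' = diag_monom D' S + diag_monom (D - D') T"
          using diag_monom_restrict[OF finD sub, of T'] diag_monom_cong[OF T'1] diag_monom_cong[OF T'2]
          by (simp only:)
        have diagT: "diag_monom D T = diag_monom D' T + diag_monom (D - D') T"
          by (rule diag_monom_restrict[OF finD sub])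
        have let': "letters D T' \<subseteq> Z"
        proof -
          have "letters D T' = letters D' T' \<union> letters (D - D') T'"
            unfolding letters_def image_Un[symmetric] using sub by (simp only: Un_Diff_cancel Un_absorb1)
          also have "letters D' T' = letters D' S" unfolding letters_def using T'1 by (intro image_cong) auto
          also have "letters (D - D') T' = letters (D - D') T" unfolding letters_def using T'2 by (intro image_cong) auto
          also have "letters D' S \<union> letters (D - D') T \<subseteq> letters D T"
            using S(3) sub unfolding letters_def by blast
          finally show ?thesis using less.prems(2) by simp
        qed
        have strict': "row_strict D T'"
          unfolding row_strict_def
        proof (intro allI impI)
          fix r c d assume r: "(r, c) \<in> D \<and> (r, d) \<in> D \<and> c < d"
          show "T' r c < T' r d"
          proof (cases "r \<in> {i, j}")
            case True
            then have "(r, c) \<in> D'" "(r, d) \<in> D'" using r unfolding D'_def by auto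
            then show ?thesis using T'1 r straight_row_strict[OF S(2)] unfolding row_strict_def by auto
          next
            case False
            then show ?thesis using r less.prems(1) unfolding row_strict_def T'_def by auto
          qed
        qed
        have "(T', T) \<in> ?R"
        proof (cases "diag_monom D' S = diag_monom D' T")
          case True
          \<comment> \<open>With equal diagonal monomials progress shows in the entries:
            \<open>S\<close> is straight on \<open>D'\<close> and \<open>T\<close> is not, so they
            differ, and at the first difference \<open>S\<close> is smaller.\<close>
          obtain i0 k0 where ne: "(i0, k0) \<in> D'" "T i0 k0 \<noteq> S i0 k0"
          proof (atomize_elim, rule ccontr)
            assume "\<nexists>i0 k0. (i0, k0) \<in> D' \<and> T i0 k0 \<noteq> S i0 k0"
            then have eq: "T r c = S r c" if "(r, c) \<in> D'" for r c using that by blast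
            have "straight D' T"
              using S(2) unfolding straight_def by (simp add: eq cong: conj_cong) (metis eq)
            then show False using not by simp
          qed
          obtain r c where rc: "(r, c) \<in> D'" "T r c \<noteq> S r c"
            "\<And>i' k'. (i', k') \<in> D' \<Longrightarrow> (k', i') < (c, r) \<Longrightarrow> T i' k' = S i' k'"
            using first_difference[OF finD' ne(1), of T S, OF ne(2)] by metis
          have "\<not> T r c < S r c"
            using not_straight_if_first_difference_greater[OF finD' strict True rc(1) _ rc(3)[symmetric]] S(2) by blast
          then have "S r c < T r c" using rc(2) by simp
          then have lt: "T' r c < T r c" using T'1[OF rc(1)] by simp
          have "(column_word Z D T', column_word Z D T) \<in> lex less_than"
          proof (rule column_word_less[where S = T' and T = T and i = r and k = c, OF finD finZ _ _ lt])
            show "T' r c \<in> Z" using let' rc(1) sub unfolding letters_def by force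
            show "(r, c) \<in> D" using rc(1) sub by blast
            show "T i' k' = T' i' k'" if "(i', k') \<in> D" "(k', i') < (c, r)" for i' k'
              using that rc(3)[of i' k'] T'1[of i' k'] T'2[of i' k'] by (cases "(i', k') \<in> D'") auto
          qed
          moreover have "rank T' = rank T" unfolding rank_def diagT diagT' True ..
          ultimately show ?thesis by simp
        next
          case False
          then have less: "prec (diag_monom D' T) (diag_monom D' S)" using cmp by simp
          have over: "diag_monom D'' T'' \<in> M" if "D'' \<subseteq> D" for D'' T''
            unfolding diag_monom_def
          proof (rule monoms_over_sum)
            fix c assume "c \<in> D''"
            then have "snd c \<in> P" using that D(2) by blast
            then show "(case c of (i, k) \<Rightarrow> monom_var (T'' i k) k) \<in> M" by (cases c) (simp add: monom_var_over)
          qed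
          have "prec (diag_monom D T) (diag_monom D T')"
            unfolding diagT diagT' by (rule add_right_mono[OF over[OF sub] over[OF sub] over[OF Diff_subset] less])
          then have "rank T' < rank T" using rank_less less.prems(2) let' by blast
          then show ?thesis by simp
        qed
        then show ?thesis unfolding br using less.IH strict' let' by blast
      qed
      show ?thesis by (rule span_subst[OF in_span]) (use each in blast)
    qed
  qed
  from this[OF assms(3)] show ?thesis unfolding Z_def by simp
qed

lemma straightening:
  assumes "row_convex_shape D" "snd ` D \<subseteq> P"
  shows "(bracket D T :: ('a, 'k) lpoly) \<in> lpm.span {bracket D S | S. straight D S}"
proof (cases "bracket D T = (0 :: ('a, 'k) lpoly)")
  case True
  then show ?thesis using lpm.span_zero by simp
next
  case False
  then obtain S and e :: "('a, 'k) lpoly" where S: "row_strict D S" "e \<in> {1, -1}" "bracket D T = e * bracket D S"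
    using bracket_eq_row_strict[OF assms(1)] by metis
  have "bracket D S \<in> lpm.span {bracket D S :: ('a, 'k) lpoly | S. straight D S}"
    by (rule straightening_row_strict[OF assms S(1)])
  moreover have "e \<in> {0, 1, -1}" using S(2) by (rule insertI2)
  ultimately show ?thesis unfolding S(3) by (rule span_scale_unit_or_zero[rotated])
qed

end

section \<open>Generated subalgebras and finite products\<close>

lemma subalgebra_hull: "subalgebra (subalgebra hull G)"
  by (rule hull_in) (auto simp: subalgebra_def)

lemma subalgebra_prod:
  assumes A: "subalgebra A" and f: "\<And>i. i \<in> I \<Longrightarrow> f i \<in> A"
  shows "prod f I \<in> A"
proof -
  have one: "1 \<in> A" using A unfolding subalgebra_def single_one[symmetric] by blast
  show ?thesis using f
  proof (induction I rule: infinite_finite_induct)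
    case (insert i I)
    then have "f i * prod f I \<in> A" using A unfolding subalgebra_def by blast
    then show ?case using insert.hyps by simp
  qed (simp_all add: one)
qed

lemma span_subset_subalgebra:
  assumes "subalgebra A" "G \<subseteq> A"
  shows "lpm.span G \<subseteq> A"
proof (rule lpm.span_minimal[OF assms(2)])
  show "lpm.subspace A"
    unfolding lpm.subspace_def using assms(1) unfolding subalgebra_def by (metis single_zero)
qed

lemma prod_lessThan_add:
  fixes f :: "nat \<Rightarrow> 'r::comm_monoid_mult"
  shows "(\<Prod>l<n + n'. f l) = (\<Prod>l<n. f l) * (\<Prod>l<n'. f (n + l))"
  by (induction n') (simp_all add: mult_ac)

section \<open>Products of generators\<close>

text \<open>Each row is repeated \<open>n\<close> times: row \<open>n * i + l\<close> is the \<open>l\<close>-th copy of row \<open>i\<close>.\<close>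

definition multiple_shape :: "nat \<Rightarrow> shape \<Rightarrow> shape" where
  "multiple_shape n D = (\<lambda>(l, i, k). (n * i + l, k)) ` ({..<n} \<times> D)"

lemma mem_multiple_shape: "(r, k) \<in> multiple_shape n D \<longleftrightarrow> 0 < n \<and> (r div n, k) \<in> D"
proof
  assume "(r, k) \<in> multiple_shape n D"
  then show "0 < n \<and> (r div n, k) \<in> D" unfolding multiple_shape_def by auto
next
  assume "0 < n \<and> (r div n, k) \<in> D"
  then have "(r mod n, r div n, k) \<in> {..<n} \<times> D" "(r, k) = (\<lambda>(l, i, k). (n * i + l, k)) (r mod n, r div n, k)"
    by auto
  then show "(r, k) \<in> multiple_shape n D" unfolding multiple_shape_def by (rule rev_image_eqI)
qed

lemma mult_add_less_eq_iff:
  fixes n :: nat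
  assumes "l < n" "l' < n"
  shows "n * i + l = n * i' + l' \<longleftrightarrow> l = l' \<and> i = i'"
proof
  assume eq: "n * i + l = n * i' + l'"
  have "(n * i + l) div n = i" "(n * i + l) mod n = l" "(n * i' + l') div n = i'" "(n * i' + l') mod n = l'"
    using assms by simp_all
  then show "l = l' \<and> i = i'" unfolding eq by simp
qed simp

lemma inj_multiple_shape:
  fixes n :: nat and D :: shape
  shows "inj_on (\<lambda>(l, i, k). (n * i + l, k)) ({..<n} \<times> D)"
  by (auto simp: inj_on_def dest: mult_add_less_eq_iff[THEN iffD1, rotated 2])

lemma row_columns_multiple_shape:
  "0 < n \<Longrightarrow> row_columns (multiple_shape n D) r = row_columns D (r div n)"
  unfolding row_columns_def by (simp add: mem_multiple_shape)

lemma finite_multiple_shape: "finite D \<Longrightarrow> finite (multiple_shape n D)"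
  unfolding multiple_shape_def by simp

lemma row_convex_multiple_shape:
  assumes "row_convex_shape D"
  shows "row_convex_shape (multiple_shape n D)"
proof (cases "n = 0")
  case True
  then show ?thesis
    by (simp add: multiple_shape_def row_convex_shape_def row_convex_def rows_sorted_def row_columns_def)
next
  case False
  have D: "finite D" "row_convex D" "rows_sorted D" using assms unfolding row_convex_shape_def by auto
  show ?thesis
    unfolding row_convex_shape_def
  proof (intro conjI)
    show "finite (multiple_shape n D)" by (rule finite_multiple_shape[OF D(1)])
    show "row_convex (multiple_shape n D)"
      using D(2) unfolding row_convex_def mem_multiple_shape by blast
    show "rows_sorted (multiple_shape n D)"
      unfolding rows_sorted_def
    proof (intro allI impI)
      fix r r'
      assume r: "r < r' \<and> row_columns (multiple_shape n D) r \<noteq> {} \<and> row_columns (multiple_shape n D) r' \<noteq> {}"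
      \<comment> \<open>Copies of a row are consecutive and have the same end; copies of different
        rows keep the order of the originals.\<close>
      have "r div n = r' div n \<or> r div n < r' div n" using r div_le_mono[of r r' n] by linarith
      then show "Max (row_columns (multiple_shape n D) r') \<le> Max (row_columns (multiple_shape n D) r)"
        using r D(3) False unfolding rows_sorted_def by (auto simp: row_columns_multiple_shape)
    qed
  qed
qed

lemma snd_multiple_shape: "snd ` multiple_shape n D \<subseteq> snd ` D"
  unfolding multiple_shape_def by force

lemma bracket_multiple_shape:
  "bracket (multiple_shape n D) S = (\<Prod>l<n. bracket D (\<lambda>i. S (n * i + l)) :: ('a, 'k::comm_ring_1) lpoly)"
proof -
  let ?h = "\<lambda>(l, i). n * i + l"
  have rows: "fst ` multiple_shape n D = ?h ` ({..<n} \<times> fst ` D)"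
    unfolding multiple_shape_def by force
  have inj: "inj_on ?h ({..<n} \<times> fst ` D)"
    by (auto simp: inj_on_def dest: mult_add_less_eq_iff[THEN iffD1, rotated 2])
  have "bracket (multiple_shape n D) S =
      (\<Prod>(l, i)\<in>{..<n} \<times> fst ` D. row_biproduct (multiple_shape n D) S (n * i + l) :: ('a, 'k) lpoly)"
    unfolding bracket_def rows prod.reindex[OF inj] by (intro prod.cong) auto
  also have "\<dots> = (\<Prod>(l, i)\<in>{..<n} \<times> fst ` D. row_biproduct D (\<lambda>i. S (n * i + l)) i)"
    by (intro prod.cong refl) (auto simp: row_biproduct_def row_columns_multiple_shape)
  also have "\<dots> = (\<Prod>l<n. \<Prod>i\<in>fst ` D. row_biproduct D (\<lambda>i. S (n * i + l)) i)"
    by (rule prod.cartesian_product[symmetric])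
  finally show ?thesis unfolding bracket_def .
qed

lemma diag_monom_multiple_shape:
  "diag_monom (multiple_shape n D) S = (\<Sum>l<n. diag_monom D (\<lambda>i. S (n * i + l)))"
proof -
  have "diag_monom (multiple_shape n D) S = (\<Sum>(l, c)\<in>{..<n} \<times> D. case c of (i, k) \<Rightarrow> monom_var (S (n * i + l) k) k)"
    unfolding diag_monom_def multiple_shape_def sum.reindex[OF inj_multiple_shape] by (intro sum.cong) auto
  also have "\<dots> = (\<Sum>l<n. \<Sum>(i, k)\<in>D. monom_var (S (n * i + l) k) k)"
    by (rule sum.cartesian_product[symmetric])
  finally show ?thesis unfolding diag_monom_def .
qed

text \<open>The degree in the variables of one nonempty column is \<open>n\<close> times the number
  of cells of \<open>D\<close> in it, which recovers \<open>n\<close>. So products of different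
  lengths have different initial monomials.\<close>

lemma diag_monom_multiple_shape_eq:
  assumes D: "finite D" "D \<noteq> {}" and eq: "diag_monom (multiple_shape n D) S = diag_monom (multiple_shape n' D) S'"
  shows "n = n'"
proof -
  obtain i0 k where k: "(i0, k) \<in> D" using D(2) by auto
  have size: "(\<Sum>a\<in>A. Poly_Mapping.lookup (diag_monom (multiple_shape n D) S) (a, k)) = n * card {i. (i, k) \<in> D}"
    if "finite A" "letters (multiple_shape n D) S \<subseteq> A" for A n S
  proof -
    let ?E = "multiple_shape n D"
    have finE: "finite ?E" using D(1) by (rule finite_multiple_shape)
    have "{r. (r, k) \<in> ?E} \<subseteq> fst ` ?E" by (auto intro: rev_image_eqI)
    then have fin: "finite {r. (r, k) \<in> ?E}" using finE finite_subset by blast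
    have "(\<Sum>a\<in>A. Poly_Mapping.lookup (diag_monom ?E S) (a, k)) = (\<Sum>a\<in>A. card {r. (r, k) \<in> ?E \<and> S r k = a})"
      by (rule sum.cong[OF refl lookup_diag_monom[OF finE]])
    also have "\<dots> = card (\<Union>a\<in>A. {r. (r, k) \<in> ?E \<and> S r k = a})"
      using that(1) fin by (intro card_UN_disjoint[symmetric]) auto
    also have "(\<Union>a\<in>A. {r. (r, k) \<in> ?E \<and> S r k = a}) = {r. (r, k) \<in> ?E}"
      using that(2) unfolding letters_def by force
    also have "{r. (r, k) \<in> ?E} = (\<lambda>c. fst ((\<lambda>(l, i, k). (n * i + l, k)) c)) ` ({..<n} \<times> {c \<in> D. snd c = k})"
      unfolding multiple_shape_def by force
    also have "card \<dots> = card ({..<n} \<times> {c \<in> D. snd c = k})"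
    proof (rule card_image, rule inj_onI)
      fix x y assume xy: "x \<in> {..<n} \<times> {c \<in> D. snd c = k}" "y \<in> {..<n} \<times> {c \<in> D. snd c = k}"
        "fst ((\<lambda>(l, i, k). (n * i + l, k)) x) = fst ((\<lambda>(l, i, k). (n * i + l, k)) y)"
      then have "(\<lambda>(l, i, k). (n * i + l, k)) x = (\<lambda>(l, i, k). (n * i + l, k)) y" by auto
      then show "x = y" using inj_onD[OF inj_multiple_shape[of n D], of x y] xy(1,2) by blast
    qed
    also have "\<dots> = n * card {c \<in> D. snd c = k}" by (simp add: card_cartesian_product)
    also have "{c \<in> D. snd c = k} = (\<lambda>i. (i, k)) ` {i. (i, k) \<in> D}" by force
    also have "card \<dots> = card {i. (i, k) \<in> D}" by (intro card_image inj_onI) simp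
    finally show ?thesis .
  qed
  let ?A = "letters (multiple_shape n D) S \<union> letters (multiple_shape n' D) S'"
  have "finite ?A" unfolding letters_def using D(1) by (simp add: finite_multiple_shape)
  then have "n * card {i. (i, k) \<in> D} = n' * card {i. (i, k) \<in> D}"
    using size[of ?A n S] size[of ?A n' S'] eq by auto
  moreover have "finite {i. (i, k) \<in> D}" by (rule finite_subset[of _ "fst ` D"]) (use D(1) in \<open>auto intro: rev_image_eqI\<close>)
  then have "card {i. (i, k) \<in> D} \<noteq> 0" using k by auto
  ultimately show ?thesis by simp
qed

text \<open>Concatenating two finite sequences of tableaux multiplies the corresponding products, so
  their span is closed under multiplication. The empty product supplies the constants.\<close>

lemma shape_algebra_subset_span:
  "(shape_algebra D :: ('a, 'k::comm_ring_1) lpoly set) \<subseteq> lpm.span {\<Prod>l<n. bracket D (T l) | (n :: nat) T. True}"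
    (is "_ \<subseteq> lpm.span ?Q")
  unfolding shape_algebra_def
proof (rule hull_minimal)
  have memQ: "(\<Prod>l<n. bracket D (T l)) \<in> ?Q" for n :: nat and T by blast
  show "range (bracket D) \<subseteq> lpm.span ?Q"
  proof
    fix f :: "('a, 'k) lpoly" assume "f \<in> range (bracket D)"
    then obtain T where "f = bracket D T" by blast
    then have "f = (\<Prod>l<1::nat. bracket D ((\<lambda>_. T) l))" by simp
    then show "f \<in> lpm.span ?Q" using lpm.span_base[OF memQ[where n = 1 and T = "\<lambda>_. T"]] by (simp only:)
  qed
  have mult: "f * g \<in> ?Q" if fg: "f \<in> ?Q" "g \<in> ?Q" for f g
  proof -
    obtain n n' :: nat and T T' where "f = (\<Prod>l<n. bracket D (T l))" "g = (\<Prod>l<n'. bracket D (T' l))" using fg by blast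
    then have "f * g = (\<Prod>l<n + n'. bracket D ((\<lambda>l. if l < n then T l else T' (l - n)) l))"
      unfolding prod_lessThan_add by simp
    then show ?thesis using memQ[where n = "n + n'" and T = "\<lambda>l. if l < n then T l else T' (l - n)"] by (simp only:)
  qed
  have mult': "f * g \<in> lpm.span ?Q" if fg: "f \<in> lpm.span ?Q" "g \<in> lpm.span ?Q" for f g
  proof (rule span_subst[OF span_mult_right[OF fg(1)]])
    fix x assume "x \<in> (\<lambda>a. a * g) ` ?Q"
    then obtain a where a: "a \<in> ?Q" "x = g * a" by (auto simp: mult.commute)
    show "x \<in> lpm.span ?Q"
      unfolding a(2)
    proof (rule span_subst[OF span_mult_right[OF fg(2)]])
      fix y assume "y \<in> (\<lambda>b. b * a) ` ?Q"
      then show "y \<in> lpm.span ?Q" using mult a(1) by (intro lpm.span_base) blast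
    qed
  qed
  have one: "1 \<in> lpm.span ?Q" using lpm.span_base[OF memQ[where n = 0 and T = "\<lambda>_. undefined"]] by simp
  have "Poly_Mapping.single 0 c \<in> lpm.span ?Q" for c
    using lpm.span_scale[OF one, of c] by simp
  then show "subalgebra (lpm.span ?Q)"
    unfolding subalgebra_def using mult' lpm.span_add by blast
qed

section \<open>Initial monomials of the generated algebra\<close>

context diagonal_order
begin

lemma shape_algebra_subset_span_straight:
  assumes D: "row_convex_shape D" "snd ` D \<subseteq> P"
  shows "(shape_algebra D :: ('a, 'k) lpoly set) \<subseteq>
    lpm.span {bracket (multiple_shape n D) S | n S. straight (multiple_shape n D) S}" (is "_ \<subseteq> lpm.span ?B")
proof
  fix f :: "('a, 'k) lpoly" assume "f \<in> shape_algebra D"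
  then have "f \<in> lpm.span {\<Prod>l<n. bracket D (T l) | (n :: nat) T. True}" using shape_algebra_subset_span by blast
  then show "f \<in> lpm.span ?B"
  proof (rule span_subst)
    fix g :: "('a, 'k) lpoly" assume "g \<in> {\<Prod>l<n. bracket D (T l) | (n :: nat) T. True}"
    then obtain n and T :: "nat \<Rightarrow> 'a tableau" where g: "g = (\<Prod>l<n. bracket D (T l))"
      unfolding mem_Collect_eq by (elim exE conjE)
    \<comment> \<open>Interleaves the factors: copy \<open>l\<close> of each row is taken from
      \<open>T l\<close>.\<close>
    define S where "S r = T (r mod n) (r div n)" for r
    have "bracket (multiple_shape n D) S = g"
      unfolding bracket_multiple_shape g
    proof (intro prod.cong refl)
      fix l assume "l \<in> {..<n}"
      then have "(\<lambda>i. S (n * i + l)) = T l" by (auto simp: S_def)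
      then show "bracket D (\<lambda>i. S (n * i + l)) = bracket D (T l)" by simp
    qed
    moreover have "bracket (multiple_shape n D) S \<in>
        lpm.span {bracket (multiple_shape n D) S :: ('a, 'k) lpoly | S. straight (multiple_shape n D) S}"
      using D(2) snd_multiple_shape by (intro straightening row_convex_multiple_shape D(1)) blast
    ultimately show "g \<in> lpm.span ?B"
      using lpm.span_mono[of "{bracket (multiple_shape n D) S | S. straight (multiple_shape n D) S}" ?B] by blast
  qed
qed

lemma multiple_straight_initial_inj:
  assumes D: "finite D" "snd ` D \<subseteq> P"
  shows "inj_on (initial_monom prec) {bracket (multiple_shape n D) S :: ('a, 'k) lpoly | n S. straight (multiple_shape n D) S}"
proof (rule inj_onI)
  fix f g assume f: "f \<in> {bracket (multiple_shape n D) S :: ('a, 'k) lpoly | n S. straight (multiple_shape n D) S}"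
    and g: "g \<in> {bracket (multiple_shape n D) S :: ('a, 'k) lpoly | n S. straight (multiple_shape n D) S}"
    and eq: "initial_monom prec f = initial_monom prec g"
  obtain n S n' S' where S: "f = bracket (multiple_shape n D) S" "straight (multiple_shape n D) S"
    "g = bracket (multiple_shape n' D) S'" "straight (multiple_shape n' D) S'" using f g by blast
  have fin: "finite (multiple_shape n D)" for n by (rule finite_multiple_shape[OF D(1)])
  have snd: "snd ` multiple_shape n D \<subseteq> P" for n using snd_multiple_shape D(2) by blast
  show "f = g"
  proof (cases "D = {}")
    \<comment> \<open>Multiples of the empty shape are all empty and do not determine
      \<open>n\<close>, but then every bracket is \<open>1\<close>.\<close>
    case True
    then show ?thesis unfolding S(1,3) by (simp add: multiple_shape_def bracket_def)
  next
    case False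
    have "diag_monom (multiple_shape n D) S = diag_monom (multiple_shape n' D) S'"
      using eq lead_initial[OF straight_lead[OF fin snd S(2)]] lead_initial[OF straight_lead[OF fin snd S(4)]]
      unfolding S(1,3) by simp
    then have "n = n'" by (rule diag_monom_multiple_shape_eq[OF D(1) False])
    then have "f \<in> {bracket (multiple_shape n D) S | S. straight (multiple_shape n D) S}"
      "g \<in> {bracket (multiple_shape n D) S | S. straight (multiple_shape n D) S}"
      using S by auto
    then show ?thesis using inj_onD[OF straight_initial_inj[OF fin snd] eq] by blast
  qed
qed

text \<open>Expand the bracket of \<open>T\<close> in straight brackets. Their initial monomials are
  distinct, so one of them supplies the initial monomial of the sum, which is the diagonal monomial
  of \<open>T\<close>.\<close>

lemma row_strict_initial_straight:
  assumes D: "row_convex_shape D" "snd ` D \<subseteq> P" and T: "row_strict D T"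
  obtains U where "straight D U" "lead (bracket D U) (diag_monom D T)"
proof -
  let ?A = "{bracket D S :: ('a, 'k) lpoly | S. straight D S}"
  have fin: "finite D" using D(1) unfolding row_convex_shape_def by blast
  have l: "lead (bracket D T) (diag_monom D T)" by (rule bracket_lead[OF fin D(2) T])
  then have ne: "bracket D T \<noteq> (0 :: ('a, 'k) lpoly)" unfolding leads_def by auto
  have lead: "lead a (initial_monom prec a)" if "a \<in> ?A" for a
  proof -
    from that obtain S where S: "a = bracket D S" "straight D S" by blast
    show ?thesis using straight_lead[OF fin D(2) S(2)] lead_initial[OF straight_lead[OF fin D(2) S(2)]]
      unfolding S(1) by simp
  qed
  obtain a where a: "a \<in> ?A" "lead (bracket D T) (initial_monom prec a)"
    using span_lead[OF straightening[OF D] ne lead straight_initial_inj[OF fin D(2)]] by blast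
  then have "initial_monom prec a = diag_monom D T" using lead_unique l by blast
  then show thesis using a(1) lead[OF a(1)] that by auto
qed

lemma straight_generates:
  assumes D: "row_convex_shape D" "snd ` D \<subseteq> P"
  shows "subalgebra hull {bracket D T | T. straight D T} = (shape_algebra D :: ('a, 'k) lpoly set)"
proof
  show "subalgebra hull {bracket D T | T. straight D T} \<subseteq> (shape_algebra D :: ('a, 'k) lpoly set)"
    unfolding shape_algebra_def by (intro hull_mono) blast
  show "(shape_algebra D :: ('a, 'k) lpoly set) \<subseteq> subalgebra hull {bracket D T | T. straight D T}"
    unfolding shape_algebra_def
  proof (rule hull_minimal)
    show "subalgebra (subalgebra hull {bracket D T | T. straight D T} :: ('a, 'k) lpoly set)"
      by (rule subalgebra_hull)
    have "lpm.span {bracket D T | T. straight D T} \<subseteq>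
        (subalgebra hull {bracket D T | T. straight D T} :: ('a, 'k) lpoly set)"
      by (intro span_subset_subalgebra subalgebra_hull hull_subset)
    then show "range (bracket D) \<subseteq> (subalgebra hull {bracket D T | T. straight D T} :: ('a, 'k) lpoly set)"
      using straightening[OF D] by blast
  qed
qed

lemma shape_algebra_initial:
  fixes f :: "('a, 'k) lpoly"
  assumes D: "row_convex_shape D" "snd ` D \<subseteq> P" and f: "f \<in> shape_algebra D" "f \<noteq> 0"
  shows "(poly_of_monom (initial_monom prec f) :: ('a, 'k) lpoly) \<in> subalgebra hull
    ((\<lambda>g. poly_of_monom (initial_monom prec g)) ` ({bracket D T :: ('a, 'k) lpoly | T. straight D T} - {0}))"
    (is "_ \<in> subalgebra hull ?I")
proof -
  let ?B = "{bracket (multiple_shape n D) S :: ('a, 'k) lpoly | n S. straight (multiple_shape n D) S}"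
  have finD: "finite D" using D(1) unfolding row_convex_shape_def by blast
  have fin: "finite (multiple_shape n D)" for n by (rule finite_multiple_shape[OF finD])
  have snd: "snd ` multiple_shape n D \<subseteq> P" for n using snd_multiple_shape D(2) by blast
  have lead: "lead a (initial_monom prec a)" if "a \<in> ?B" for a
  proof -
    from that obtain n S where S: "a = bracket (multiple_shape n D) S" "straight (multiple_shape n D) S" by blast
    show ?thesis using straight_lead[OF fin snd S(2)] lead_initial[OF straight_lead[OF fin snd S(2)]]
      unfolding S(1) by simp
  qed
  have "f \<in> lpm.span ?B" using shape_algebra_subset_span_straight[OF D] f(1) by blast
  from span_lead[OF this f(2) lead multiple_straight_initial_inj[OF finD D(2)]]
  obtain a where a: "a \<in> ?B" "lead f (initial_monom prec a)" by blast
  then obtain n S where S: "a = bracket (multiple_shape n D) S" "straight (multiple_shape n D) S" by blast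
  have "initial_monom prec f = diag_monom (multiple_shape n D) S"
    using lead_initial[OF a(2)] lead_initial[OF straight_lead[OF fin snd S(2)]] unfolding S(1) by simp
  also have "\<dots> = (\<Sum>l<n. diag_monom D (\<lambda>i. S (n * i + l)))" by (rule diag_monom_multiple_shape)
  finally have "poly_of_monom (initial_monom prec f) =
      (\<Prod>l<n. poly_of_monom (diag_monom D (\<lambda>i. S (n * i + l))) :: ('a, 'k) lpoly)"
    by (simp only: poly_of_monom_sum)
  \<comment> \<open>The \<open>l\<close>-th copies of all rows form a tableau of shape
    \<open>D\<close> with strict rows, whose diagonal monomial is the initial monomial of a straight
    bracket.\<close>
  moreover have "poly_of_monom (diag_monom D (\<lambda>i. S (n * i + l))) \<in> ?I" if "l < n" for l
  proof -
    have "row_strict D (\<lambda>i. S (n * i + l))"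
      using straight_row_strict[OF S(2)] that unfolding row_strict_def mem_multiple_shape by simp
    then obtain U where U: "straight D U" "lead (bracket D U) (diag_monom D (\<lambda>i. S (n * i + l)))"
      using row_strict_initial_straight[OF D] by blast
    have "bracket D U \<noteq> (0 :: ('a, 'k) lpoly)" using U(2) unfolding leads_def by auto
    moreover have "initial_monom prec (bracket D U :: ('a, 'k) lpoly) = diag_monom D (\<lambda>i. S (n * i + l))"
      by (rule lead_initial[OF U(2)])
    ultimately show ?thesis using U(1) by (intro image_eqI[of _ _ "bracket D U"]) auto
  qed
  then have "(\<Prod>l<n. poly_of_monom (diag_monom D (\<lambda>i. S (n * i + l))) :: ('a, 'k) lpoly) \<in> subalgebra hull ?I"
    by (intro subalgebra_prod subalgebra_hull hull_inc) simp
  ultimately show ?thesis by simp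
qed

end

theorem theorem7p5:
  fixes D :: shape and P :: "nat set"
    and prec :: "'a::linorder lmonom \<Rightarrow> 'a lmonom \<Rightarrow> bool"
  assumes "row_convex_shape D"
    and "finite P" and "snd ` D \<subseteq> P"
    and "diagonal_term_order TYPE('k::field) P prec"
  shows "sagbi_basis prec (shape_algebra D :: ('a, 'k) lpoly set) {bracket D T | T. straight D T}"
proof -
  interpret diagonal_order P prec "TYPE('k)" by unfold_locales (rule assms(4))
  show ?thesis
    unfolding sagbi_basis_def
    using straight_generates[OF assms(1,3)] shape_algebra_initial[OF assms(1,3)] by blast
qed

end
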